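(* Let $\lambda\in\mathbb{R}\setminus\{-1,0\}$, $\mathcal{H}=\mathcal{K}\oplus\mathcal{K}$, and let $T\in\mathcal{B}(\mathcal{H})$ be a self-adjoint operator in generic position with respect to $\lambda$ such that $T-\frac{1+\lambda}{2}I=B\oplus(-B)$ for a positive $B\in\mathcal{B}(\mathcal{K})$ with $\frac{|1-|\lambda||}{2}I<B<\frac{1+|\lambda|}{2}I$. Then $$W^*(\mathcal{T}_\lambda)=M_2(\{B\}')\quad\text{and}\quad (W^*(\mathcal{T}_\lambda))'=W^*(B)^{(2)}.$$
   Context: $\mathcal{H}$ is an infinite-dimensional complex Hilbert space; "projection" means orthogonal projection; $\mathcal{P}(\mathcal{H})$ is the set of projections. For self-adjoint $A,C$, $A<C$ means $C-A$ is positive and injective. $T$ is in generic position with respect to $\lambda$ if $\mathcal{N}(T),\mathcal{N}(T-I),\mathcal{N}(T-\lambda I),\mathcal{N}(T-(1+\lambda)I)$ are all $\{0\}$. $\mathcal{T}_\lambda=\{(P,Q)\in\mathcal{P}(\mathcal{H})\times\mathcal{P}(\mathcal{H}): T=\lambda P+Q\}$, and $W^*(\mathcal{T}_\lambda)$ is the von Neumann algebra generated by all $P,Q$ with $(P,Q)\in\mathcal{T}_\lambda$. $\mathcal{F}'$ denotes the commutant of a set $\mathcal{F}$; $W^*(B)$ is the von Neumann algebra generated by $B$. For a von Neumann algebra $\mathcal{R}$ on $\mathcal{K}$, $M_2(\mathcal{R})$ is the algebra of $2\times2$ operator matrices with entries in $\mathcal{R}$ acting on $\mathcal{K}\oplus\mathcal{K}$,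 and $\mathcal{R}^{(2)}=\{R\oplus R:R\in\mathcal{R}\}$. *)

theory Defs
  imports "HOL-Analysis.Analysis"
begin

class chilbert = ab_group_add +
  fixes scaleC :: "complex \<Rightarrow> 'a \<Rightarrow> 'a"
    and cinner :: "'a \<Rightarrow> 'a \<Rightarrow> complex"
  assumes scaleC_add_right: "scaleC a (x + y) = scaleC a x + scaleC a y"
    and scaleC_add_left: "scaleC (a + b) x = scaleC a x + scaleC b x"
    and scaleC_scaleC: "scaleC a (scaleC b x) = scaleC (a * b) x"
    and scaleC_one: "scaleC 1 x = x"
    and cinner_add_left: "cinner (x + y) z = cinner x z + cinner y z"
    and cinner_scaleC_left: "cinner (scaleC a x) y = a * cinner x y"
    and cinner_commute: "cinner y x = cnj (cinner x y)"
    and cinner_nonneg: "0 \<le> Re (cinner x x)"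
    and cinner_eq_zero: "cinner x x = 0 \<Longrightarrow> x = 0"
    and complete: "(\<forall>e>0. \<exists>N::nat. \<forall>m\<ge>N. \<forall>n\<ge>N.
                      sqrt (Re (cinner (X m - X n) (X m - X n))) < e)
               \<Longrightarrow> \<exists>L. \<forall>e>0. \<exists>N::nat. \<forall>n\<ge>N. sqrt (Re (cinner (X n - L) (X n - L))) < e"

definition infinite_dimensional :: "'a::chilbert itself \<Rightarrow> bool" where
  "infinite_dimensional _ \<longleftrightarrow>
     (\<forall>n::nat. \<exists>f::nat \<Rightarrow> 'a. \<forall>i<n. \<forall>j<n. cinner (f i) (f j) = (if i = j then 1 else 0))"

definition clin :: "(complex \<Rightarrow> 'a \<Rightarrow> 'a) \<Rightarrow> ('a::ab_group_add \<Rightarrow> 'a) \<Rightarrow> bool" where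
  "clin sc T \<longleftrightarrow> (\<forall>x y. T (x + y) = T x + T y) \<and> (\<forall>c x. T (sc c x) = sc c (T x))"

definition bdd_op :: "(complex \<Rightarrow> 'a \<Rightarrow> 'a) \<Rightarrow> ('a \<Rightarrow> 'a \<Rightarrow> complex) \<Rightarrow> ('a::ab_group_add \<Rightarrow> 'a) \<Rightarrow> bool" where
  "bdd_op sc ip T \<longleftrightarrow> clin sc T \<and> (\<exists>M. \<forall>x. Re (ip (T x) (T x)) \<le> M * Re (ip x x))"

definition is_adjoint :: "('a \<Rightarrow> 'a \<Rightarrow> complex) \<Rightarrow> ('a \<Rightarrow> 'a) \<Rightarrow> ('a \<Rightarrow> 'a) \<Rightarrow> bool" where
  "is_adjoint ip T S \<longleftrightarrow> (\<forall>x y. ip (T x) y = ip x (S y))"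

definition adjoint :: "('a \<Rightarrow> 'a \<Rightarrow> complex) \<Rightarrow> ('a \<Rightarrow> 'a) \<Rightarrow> ('a \<Rightarrow> 'a)" where
  "adjoint ip T = (SOME S. is_adjoint ip T S)"

definition selfadj :: "(complex \<Rightarrow> 'a \<Rightarrow> 'a) \<Rightarrow> ('a \<Rightarrow> 'a \<Rightarrow> complex) \<Rightarrow> ('a::ab_group_add \<Rightarrow> 'a) \<Rightarrow> bool" where
  "selfadj sc ip T \<longleftrightarrow> bdd_op sc ip T \<and> is_adjoint ip T T"

definition is_proj :: "(complex \<Rightarrow> 'a \<Rightarrow> 'a) \<Rightarrow> ('a \<Rightarrow> 'a \<Rightarrow> complex) \<Rightarrow> ('a::ab_group_add \<Rightarrow> 'a) \<Rightarrow> bool" where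
  "is_proj sc ip P \<longleftrightarrow> selfadj sc ip P \<and> P \<circ> P = P"

definition positive_op :: "(complex \<Rightarrow> 'a \<Rightarrow> 'a) \<Rightarrow> ('a \<Rightarrow> 'a \<Rightarrow> complex) \<Rightarrow> ('a::ab_group_add \<Rightarrow> 'a) \<Rightarrow> bool" where
  "positive_op sc ip T \<longleftrightarrow> selfadj sc ip T \<and> (\<forall>x. 0 \<le> Re (ip (T x) x))"

definition op_less :: "(complex \<Rightarrow> 'a \<Rightarrow> 'a) \<Rightarrow> ('a \<Rightarrow> 'a \<Rightarrow> complex) \<Rightarrow> ('a::ab_group_add \<Rightarrow> 'a) \<Rightarrow> ('a \<Rightarrow> 'a) \<Rightarrow> bool" where
  "op_less sc ip A C \<longleftrightarrow> positive_op sc ip (\<lambda>x. C x - A x) \<and> inj (\<lambda>x. C x - A x)"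

definition commutant :: "(complex \<Rightarrow> 'a \<Rightarrow> 'a) \<Rightarrow> ('a \<Rightarrow> 'a \<Rightarrow> complex) \<Rightarrow> ('a::ab_group_add \<Rightarrow> 'a) set \<Rightarrow> ('a \<Rightarrow> 'a) set" where
  "commutant sc ip F = {A. bdd_op sc ip A \<and> (\<forall>X\<in>F. A \<circ> X = X \<circ> A)}"

definition vN_alg :: "(complex \<Rightarrow> 'a \<Rightarrow> 'a) \<Rightarrow> ('a \<Rightarrow> 'a \<Rightarrow> complex) \<Rightarrow> ('a::ab_group_add \<Rightarrow> 'a) set \<Rightarrow> bool" where
  "vN_alg sc ip R \<longleftrightarrow> (\<forall>A\<in>R. bdd_op sc ip A \<and> adjoint ip A \<in> R)
                     \<and> commutant sc ip (commutant sc ip R) = R"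

definition Wstar :: "(complex \<Rightarrow> 'a \<Rightarrow> 'a) \<Rightarrow> ('a \<Rightarrow> 'a \<Rightarrow> complex) \<Rightarrow> ('a::ab_group_add \<Rightarrow> 'a) set \<Rightarrow> ('a \<Rightarrow> 'a) set" where
  "Wstar sc ip S = \<Inter> {R. vN_alg sc ip R \<and> S \<subseteq> R}"

definition scH :: "complex \<Rightarrow> 'k::chilbert \<times> 'k \<Rightarrow> 'k \<times> 'k" where
  "scH c h = (scaleC c (fst h), scaleC c (snd h))"

definition ipH :: "'k::chilbert \<times> 'k \<Rightarrow> 'k \<times> 'k \<Rightarrow> complex" where
  "ipH h g = cinner (fst h) (fst g) + cinner (snd h) (snd g)"

definition generic_position :: "real \<Rightarrow> ('k::chilbert \<times> 'k \<Rightarrow> 'k \<times> 'k) \<Rightarrow> bool" where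
  "generic_position lam T \<longleftrightarrow>
     (\<forall>\<mu>\<in>{0, 1, complex_of_real lam, 1 + complex_of_real lam}.
        \<forall>h. T h = scH \<mu> h \<longrightarrow> h = 0)"

definition T_lam :: "real \<Rightarrow> ('k::chilbert \<times> 'k \<Rightarrow> 'k \<times> 'k) \<Rightarrow>
    (('k \<times> 'k \<Rightarrow> 'k \<times> 'k) \<times> ('k \<times> 'k \<Rightarrow> 'k \<times> 'k)) set" where
  "T_lam lam T = {(P, Q). is_proj scH ipH P \<and> is_proj scH ipH Q \<and>
                          T = (\<lambda>h. scH (complex_of_real lam) (P h) + Q h)}"

definition M2 :: "('k::chilbert \<Rightarrow> 'k) set \<Rightarrow> ('k \<times> 'k \<Rightarrow> 'k \<times> 'k) set" where
  "M2 R = {(\<lambda>h. (a (fst h) + b (snd h), c (fst h) + d (snd h))) | a b c d.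
             a \<in> R \<and> b \<in> R \<and> c \<in> R \<and> d \<in> R}"

definition ampl2 :: "('k::chilbert \<Rightarrow> 'k) set \<Rightarrow> ('k \<times> 'k \<Rightarrow> 'k \<times> 'k) set" where
  "ampl2 R = {(\<lambda>h. (A (fst h), A (snd h))) | A. A \<in> R}"

end

theory Submission
  imports Defs
begin

text \<open>
  Everything reduces to the commutant of the set of all \<open>P\<close> and \<open>Q\<close> being
  \<open>W\<^sup>*(B)\<^sup>(\<^sup>2\<^sup>)\<close>. Put \<open>D = T - (1+\<lambda>)/2 = B \<oplus> (-B)\<close>. If \<open>T = \<lambda>P + Q\<close>, then
  \<open>D\<^sup>2\<close> differs from \<open>\<lambda>(PQ + QP - P - Q)\<close> by a scalar, so it commutes with \<open>P\<close> and \<open>Q\<close>; hence the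
  entries of \<open>P\<close> and \<open>Q\<close> commute with \<open>B\<^sup>2\<close> and, \<open>B\<close> being positive, with \<open>B\<close>.
  Conversely, with \<open>U = 2P - 1\<close> and \<open>V = 2Q - 1\<close> the equation reads \<open>2D = \<lambda>U + V\<close>. It is solved by
  \<open>U = (c, W\<^sup>*s; sW, -c)\<close> for every unitary \<open>W\<close> commuting with \<open>B\<close>, where
  \<open>4\<lambda>cB = 4B\<^sup>2 + \<lambda>\<^sup>2 - 1\<close> and \<open>c\<^sup>2 + s\<^sup>2 = 1\<close>; the bounds on \<open>B\<close> make \<open>s\<close> injective.
  An operator commuting with all these solutions commutes with \<open>D\<close>, which kills its off-diagonal entries,
  then \<open>W = 1\<close> shows that its diagonal entries agree, and this entry commutes with every unitary \<open>W\<close>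
  in the commutant of \<open>B\<close>, hence with the whole commutant.
\<close>

section \<open>Inner product spaces and the Riesz representation theorem\<close>

text \<open>For \<open>c > 0\<close> the minimiser \<open>t = - b / c\<close> gives the bound; for
  \<open>c = 0\<close> an affine function bounded below is constant; \<open>c < 0\<close> fails for
  large \<open>t\<close>. With no assumption on the sign of \<open>c\<close> it covers degenerate
  forms, and \<open>a = 0\<close> yields \<open>b = 0\<close>.\<close>

lemma discriminant_le:
  fixes a b c :: real
  assumes "\<And>t. 0 \<le> a + 2 * b * t + c * t\<^sup>2"
  shows "b\<^sup>2 \<le> a * c"
proof (cases "c = 0")
  case True
  have "b = 0"
  proof (rule ccontr)
    assume "b \<noteq> 0"
    then show False using assms[of "- (a + 1) / (2 * b)"] True by (simp add: field_simps)
  qed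
  then show ?thesis using True by simp
next
  case False
  have "c \<ge> 0"
  proof (rule ccontr)
    assume "\<not> c \<ge> 0"
    then have c: "c < 0" by simp
    \<comment> \<open>This makes \<open>t \<ge> 1\<close> and
      \<open>\<bar>c\<bar> * t > \<bar>a\<bar> + 2 * \<bar>b\<bar>\<close>, so the quadratic is
      negative at \<open>t\<close>.\<close>
    define t where "t = (\<bar>a\<bar> + 2 * \<bar>b\<bar> + 1) / \<bar>c\<bar> + 1"
    have t1: "t \<ge> 1" unfolding t_def by simp
    have "\<bar>c\<bar> * t = \<bar>a\<bar> + 2 * \<bar>b\<bar> + 1 + \<bar>c\<bar>" using c by (simp add: t_def field_simps)
    then have "c * t = - (\<bar>a\<bar> + 2 * \<bar>b\<bar> + 1 + \<bar>c\<bar>)" using c by simp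
    then have "c * t\<^sup>2 = - (\<bar>a\<bar> + 2 * \<bar>b\<bar> + 1 + \<bar>c\<bar>) * t"
      by (simp add: power2_eq_square flip: mult.assoc)
    then have "a + 2 * b * t + c * t\<^sup>2 = (a - \<bar>a\<bar> * t) + 2 * (b - \<bar>b\<bar>) * t - t - \<bar>c\<bar> * t"
      by (simp add: algebra_simps)
    moreover have "a \<le> \<bar>a\<bar> * t" using t1 mult_left_mono[OF t1, of "\<bar>a\<bar>"] by simp
    moreover have "(b - \<bar>b\<bar>) * t \<le> 0" using t1 by (simp add: mult_nonpos_nonneg)
    moreover have "\<bar>c\<bar> * t \<ge> 0" using t1 by simp
    ultimately show False using assms[of t] t1 by linarith
  qed
  with False have c: "c > 0" by simp
  have "a + 2 * b * (- b / c) + c * (- b / c)\<^sup>2 = a - b\<^sup>2 / c"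
    using c by (simp add: field_simps power2_eq_square)
  then have "0 \<le> a - b\<^sup>2 / c" using assms[of "- b / c"] by simp
  then show ?thesis using c by (simp add: field_simps)
qed

text \<open>
  A locale rather than the class \<open>chilbert\<close>, because it is needed for \<open>ipH\<close> on pairs and for
  the equivalent inner products \<open>\<langle>Bx, y\<rangle>\<close> as well.
\<close>

locale hspace =
  fixes sc :: "complex \<Rightarrow> 'a::ab_group_add \<Rightarrow> 'a"
    and ip :: "'a \<Rightarrow> 'a \<Rightarrow> complex"
  assumes sc_add_right: "sc a (x + y) = sc a x + sc a y"
    and sc_add_left: "sc (a + b) x = sc a x + sc b x"
    and sc_sc: "sc a (sc b x) = sc (a * b) x"
    and sc_one: "sc 1 x = x"
    and ip_add_left: "ip (x + y) z = ip x z + ip y z"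
    and ip_sc_left: "ip (sc a x) y = a * ip x y"
    and ip_commute: "ip y x = cnj (ip x y)"
    and ip_nonneg: "0 \<le> Re (ip x x)"
    and ip_eq_zero: "ip x x = 0 \<Longrightarrow> x = 0"
    and ip_complete: "(\<forall>e>0. \<exists>N::nat. \<forall>m\<ge>N. \<forall>n\<ge>N.
                      sqrt (Re (ip (X m - X n) (X m - X n))) < e)
               \<Longrightarrow> \<exists>L. \<forall>e>0. \<exists>N::nat. \<forall>n\<ge>N. sqrt (Re (ip (X n - L) (X n - L))) < e"
begin

sublocale vs: vector_space sc
  by unfold_locales (simp_all add: sc_add_right sc_add_left sc_sc sc_one)

lemma ip_add_right: "ip z (x + y) = ip z x + ip z y"
  by (metis ip_commute ip_add_left complex_cnj_add)

lemma ip_sc_right: "ip x (sc a y) = cnj a * ip x y"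
  by (metis ip_commute ip_sc_left complex_cnj_mult)

lemma ip_zero_left [simp]: "ip 0 y = 0"
  using ip_add_left[of 0 0 y] by simp

lemma ip_zero_right [simp]: "ip y 0 = 0"
  using ip_add_right[of y 0 0] by simp

lemma ip_minus_left [simp]: "ip (- x) y = - ip x y"
  using ip_add_left[of x "- x" y] by (simp add: eq_neg_iff_add_eq_0 add.commute)

lemma ip_minus_right [simp]: "ip y (- x) = - ip y x"
  using ip_add_right[of y x "- x"] by (simp add: eq_neg_iff_add_eq_0 add.commute)

lemma ip_diff_left: "ip (x - y) z = ip x z - ip y z"
  using ip_add_left[of x "- y" z] by simp

lemma ip_diff_right: "ip z (x - y) = ip z x - ip z y"
  using ip_add_right[of z x "- y"] by simp

lemmas ip_simps = ip_add_left ip_add_right ip_diff_left ip_diff_right ip_sc_left ip_sc_right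

lemma Im_ip_self [simp]: "Im (ip x x) = 0"
  using ip_commute[of x x] by (metis complex_cnj_cancel_iff add.inverse_neutral cnj.simps(2) equal_neg_zero)

lemma Re_ip_commute: "Re (ip y x) = Re (ip x y)"
  using ip_commute[of x y] by simp

text \<open>Testing against an arbitrary \<open>z\<close> turns vector identities into identities of
  complex numbers, where ring arithmetic applies; many operator identities below are checked this
  way.\<close>

lemma ip_ext: "(\<And>z. ip z x = ip z y) \<Longrightarrow> x = y"
  using ip_eq_zero[of "x - y"] by (simp add: ip_diff_right)

section \<open>The norm and the Cauchy-Schwarz inequality\<close>

definition nrm :: "'a \<Rightarrow> real" where
  "nrm x = sqrt (Re (ip x x))"

lemma nrm_ge_0 [simp]: "0 \<le> nrm x"
  by (simp add: nrm_def ip_nonneg)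

lemma nrm_sq: "(nrm x)\<^sup>2 = Re (ip x x)"
  by (simp add: nrm_def ip_nonneg)

lemma nrm_0 [simp]: "nrm 0 = 0"
  by (simp add: nrm_def)

lemma nrm_eq_0 [simp]: "nrm x = 0 \<longleftrightarrow> x = 0"
proof
  assume "nrm x = 0"
  then have "ip x x = 0" by (simp add: nrm_def complex_eq_iff)
  then show "x = 0" by (rule ip_eq_zero)
qed simp

lemma nrm_minus [simp]: "nrm (- x) = nrm x"
  by (simp add: nrm_def)

lemma nrm_minus_commute: "nrm (x - y) = nrm (y - x)"
  using nrm_minus[of "x - y"] by simp

lemma nrm_sc [simp]: "nrm (sc c x) = cmod c * nrm x"
proof -
  have "Re (ip (sc c x) (sc c x)) = (cmod c)\<^sup>2 * Re (ip x x)"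
    by (simp add: ip_simps cmod_power2) (simp add: power2_eq_square algebra_simps)
  then show ?thesis
    by (simp add: nrm_def real_sqrt_mult)
qed

lemma clin_id: "clin sc (\<lambda>x. x)"
  by (simp add: clin_def)

lemma clin_0: "clin sc T \<Longrightarrow> T 0 = 0"
  unfolding clin_def by (metis add_cancel_right_right)

lemma clin_add: "clin sc T \<Longrightarrow> T (x + y) = T x + T y"
  by (simp add: clin_def)

lemma clin_sc: "clin sc T \<Longrightarrow> T (sc c x) = sc c (T x)"
  by (simp add: clin_def)

lemma clin_minus: "clin sc T \<Longrightarrow> T (- x) = - T x"
  using clin_sc[of T "-1" x] by simp

lemma clin_diff: "clin sc T \<Longrightarrow> T (x - y) = T x - T y"
  using clin_add[of T x "- y"] clin_minus[of T y] by simp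

lemmas clin_simps = clin_0 clin_add clin_sc clin_minus clin_diff

text \<open>Positivity along the line \<open>x + t y\<close> is a quadratic inequality in real
  \<open>t\<close>. The form may be degenerate; the identity as \<open>A\<close> gives the ordinary
  inequality.\<close>

lemma form_cauchy_schwarz:
  assumes A: "clin sc A" "is_adjoint ip A A" and pos: "\<And>x. 0 \<le> Re (ip (A x) x)"
  shows "(Re (ip (A x) y))\<^sup>2 \<le> Re (ip (A x) x) * Re (ip (A y) y)"
proof (rule discriminant_le)
  fix t :: real
  have "Re (ip (A y) x) = Re (ip (A x) y)"
    using A(2) Re_ip_commute unfolding is_adjoint_def by metis
  then have "Re (ip (A (x + sc (of_real t) y)) (x + sc (of_real t) y))
     = Re (ip (A x) x) + 2 * Re (ip (A x) y) * t + Re (ip (A y) y) * t\<^sup>2"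
    by (simp add: clin_simps[OF A(1)] ip_simps power2_eq_square algebra_simps)
  then show "0 \<le> Re (ip (A x) x) + 2 * Re (ip (A x) y) * t + Re (ip (A y) y) * t\<^sup>2"
    using pos by metis
qed

lemma cauchy_schwarz_Re: "\<bar>Re (ip x y)\<bar> \<le> nrm x * nrm y"
proof -
  have "(Re (ip x y))\<^sup>2 \<le> Re (ip x x) * Re (ip y y)"
    by (rule form_cauchy_schwarz[OF clin_id]) (simp_all add: is_adjoint_def ip_nonneg)
  then have "(Re (ip x y))\<^sup>2 \<le> (nrm x * nrm y)\<^sup>2"
    by (simp add: nrm_sq power_mult_distrib)
  then show ?thesis
    by (simp add: abs_le_square_iff[symmetric])
qed

text \<open>The superfluous factor 2 saves the choice of a phase.\<close>

lemma cmod_ip_le: "cmod (ip x y) \<le> 2 * (nrm x * nrm y)"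
proof -
  have "Im (ip x y) = Re (ip (sc (- \<i>) x) y)" by (simp add: ip_simps)
  then have "\<bar>Im (ip x y)\<bar> \<le> nrm x * nrm y"
    using cauchy_schwarz_Re[of "sc (- \<i>) x" y] by (simp del: vs.scale_minus_left)
  then show ?thesis
    using cauchy_schwarz_Re[of x y] cmod_le[of "ip x y"] by linarith
qed

lemma nrm_triangle: "nrm (x + y) \<le> nrm x + nrm y"
proof (rule power2_le_imp_le)
  have "(nrm (x + y))\<^sup>2 = (nrm x)\<^sup>2 + 2 * Re (ip x y) + (nrm y)\<^sup>2"
    using Re_ip_commute[of y x] by (simp add: nrm_sq ip_simps)
  also have "\<dots> \<le> (nrm x + nrm y)\<^sup>2"
    using cauchy_schwarz_Re[of x y] by (simp add: power2_sum)
  finally show "(nrm (x + y))\<^sup>2 \<le> (nrm x + nrm y)\<^sup>2" .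
qed simp

lemma nrm_triangle_diff: "nrm (x - y) \<le> nrm x + nrm y"
  using nrm_triangle[of x "- y"] by simp

section \<open>Convergence in norm\<close>

definition cvg :: "(nat \<Rightarrow> 'a) \<Rightarrow> 'a \<Rightarrow> bool" where
  "cvg X L \<longleftrightarrow> (\<lambda>n. nrm (X n - L)) \<longlonglongrightarrow> 0"

lemma complete_cvg:
  assumes "\<And>e. e > 0 \<Longrightarrow> \<exists>N::nat. \<forall>m\<ge>N. \<forall>n\<ge>N. nrm (X m - X n) < e"
  shows "\<exists>L. cvg X L"
proof -
  obtain L where "\<forall>e>0. \<exists>N::nat. \<forall>n\<ge>N. nrm (X n - L) < e"
    using ip_complete[of X] assms unfolding nrm_def by blast
  then show ?thesis
    unfolding cvg_def LIMSEQ_def by auto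
qed

lemma cvg_bound:
  assumes "\<And>n. nrm (X n - L) \<le> f n" "f \<longlonglongrightarrow> 0"
  shows "cvg X L"
  unfolding cvg_def
  by (rule tendsto_sandwich[OF _ _ tendsto_const assms(2)]) (auto simp: assms(1))

lemma cvg_add:
  assumes "cvg X L" "cvg Y M"
  shows "cvg (\<lambda>n. X n + Y n) (L + M)"
proof (rule cvg_bound)
  fix n
  have "X n + Y n - (L + M) = (X n - L) + (Y n - M)" by simp
  then show "nrm (X n + Y n - (L + M)) \<le> nrm (X n - L) + nrm (Y n - M)"
    using nrm_triangle by metis
  show "(\<lambda>n. nrm (X n - L) + nrm (Y n - M)) \<longlonglongrightarrow> 0"
    using tendsto_add[OF assms[unfolded cvg_def]] by simp
qed

lemma cvg_sc:
  assumes "cvg X L"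
  shows "cvg (\<lambda>n. sc c (X n)) (sc c L)"
proof (rule cvg_bound)
  fix n
  show "nrm (sc c (X n) - sc c L) \<le> cmod c * nrm (X n - L)"
    by (simp flip: vs.scale_right_diff_distrib)
  show "(\<lambda>n. cmod c * nrm (X n - L)) \<longlonglongrightarrow> 0"
    using tendsto_mult_left[OF assms[unfolded cvg_def], of "cmod c"] by simp
qed

lemma cvg_const: "cvg (\<lambda>n. L) L"
  by (simp add: cvg_def)

lemma cvg_ip:
  assumes "cvg X L"
  shows "(\<lambda>n. ip (X n) y) \<longlonglongrightarrow> ip L y"
proof (rule LIM_zero_cancel, rule Lim_null_comparison)
  show "\<forall>\<^sub>F n in sequentially. norm (ip (X n) y - ip L y) \<le> 2 * nrm y * nrm (X n - L)"
    using cmod_ip_le[of "X _ - L" y] by (auto simp: ip_diff_left mult_ac)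
  show "(\<lambda>n. 2 * nrm y * nrm (X n - L)) \<longlonglongrightarrow> 0"
    using tendsto_mult_left[OF assms[unfolded cvg_def], of "2 * nrm y"] by simp
qed

lemma cvg_unique:
  assumes "cvg X L" "cvg X M"
  shows "L = M"
proof -
  have "ip L y = ip M y" for y
    using cvg_ip[OF assms(1)] cvg_ip[OF assms(2)] LIMSEQ_unique by blast
  then show ?thesis by (metis ip_commute ip_ext)
qed

lemma cvg_nrm_le:
  assumes "cvg X L" "\<And>n. nrm (X n) \<le> k"
  shows "nrm L \<le> k"
proof -
  have "nrm L - k \<le> nrm (X n - L)" for n
  proof -
    have "nrm L = nrm (X n - (X n - L))" by simp
    also have "\<dots> \<le> nrm (X n) + nrm (X n - L)" by (rule nrm_triangle_diff)
    finally show ?thesis using assms(2)[of n] by linarith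
  qed
  then have "nrm L - k \<le> 0"
    using LIMSEQ_le_const[OF assms(1)[unfolded cvg_def]] by blast
  then show ?thesis by simp
qed

text \<open>The representing vector minimises \<open>\<parallel>x\<parallel>\<^sup>2 - 2 Re (f x)\<close>.\<close>

lemma riesz:
  assumes f_add: "\<And>x y. f (x + y) = f x + f y"
    and f_sc: "\<And>c x. f (sc c x) = c * f x"
    and f_bound: "\<And>x. cmod (f x) \<le> k * nrm x"
  shows "\<exists>z. \<forall>x. f x = ip x z"
proof -
  define \<phi> where "\<phi> x = Re (ip x x) - 2 * Re (f x)" for x
  have low: "- k\<^sup>2 \<le> \<phi> x" for x
  proof -
    have "0 \<le> (nrm x - k)\<^sup>2" by simp
    then have "- k\<^sup>2 \<le> (nrm x)\<^sup>2 - 2 * (k * nrm x)" by (simp add: power2_diff mult.commute)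
    also have "\<dots> \<le> \<phi> x"
      unfolding \<phi>_def nrm_sq[symmetric]
      using f_bound[of x] complex_Re_le_cmod[of "f x"] by linarith
    finally show ?thesis .
  qed
  then have bdd: "bdd_below (range \<phi>)" by (meson bdd_belowI2)
  define m where "m = Inf (range \<phi>)"
  have m_le: "m \<le> \<phi> x" for x
    unfolding m_def by (rule cInf_lower[OF _ bdd]) simp
  have "\<exists>x. \<phi> x < m + 1 / real (Suc n)" for n
  proof -
    have "m < m + 1 / real (Suc n)" by simp
    then show ?thesis
      unfolding m_def by (subst (asm) cInf_less_iff) (use bdd in auto)
  qed
  then obtain X where X: "\<And>n. \<phi> (X n) < m + 1 / real (Suc n)" by metis
  \<comment> \<open>Parallelogram law: the value of \<open>\<phi>\<close> at the midpoint is at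
    least \<open>m\<close>, so two near-minimisers are close together. Hence the minimising sequence
    \<open>X\<close> is Cauchy.\<close>
  have par: "(nrm (x - y))\<^sup>2 \<le> 2 * (\<phi> x - m) + 2 * (\<phi> y - m)" for x y
  proof -
    have "(nrm (x - y))\<^sup>2 = 2 * \<phi> x + 2 * \<phi> y - 4 * \<phi> (sc (1/2) (x + y))"
      by (simp add: \<phi>_def nrm_sq ip_simps f_add f_sc algebra_simps)
    then show ?thesis using m_le[of "sc (1/2) (x + y)"] by simp
  qed
  have "\<exists>L. cvg X L"
  proof (rule complete_cvg)
    fix e :: real assume e: "e > 0"
    then obtain N where N: "4 / e\<^sup>2 < real (Suc N)"
      using reals_Archimedean2 less_trans[of _ "real _" "real (Suc _)"] by (metis lessI of_nat_less_iff)
    have "nrm (X p - X q) < e" if "p \<ge> N" "q \<ge> N" for p q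
    proof (rule power2_less_imp_less)
      define d where "d r = 1 / real (Suc r)" for r
      have le: "d r \<le> d N" if "r \<ge> N" for r
        using that by (simp add: d_def frac_le)
      have "(nrm (X p - X q))\<^sup>2 < 2 * d p + 2 * d q"
      proof -
        have "\<phi> (X p) - m < d p" "\<phi> (X q) - m < d q"
          using X[of p] X[of q] by (simp_all add: d_def)
        then have "2 * (\<phi> (X p) - m) + 2 * (\<phi> (X q) - m) < 2 * d p + 2 * d q"
          by (intro add_strict_mono mult_strict_left_mono) simp_all
        with par show ?thesis by (rule le_less_trans)
      qed
      also have "\<dots> \<le> 4 * d N" using le[OF that(1)] le[OF that(2)] by linarith
      also have "\<dots> < e\<^sup>2" using N e by (simp add: d_def field_simps)
      finally show "(nrm (X p - X q))\<^sup>2 < e\<^sup>2" .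
    qed (use e in simp)
    then show "\<exists>N. \<forall>m\<ge>N. \<forall>n\<ge>N. nrm (X m - X n) < e" by blast
  qed
  then obtain z where z: "cvg X z" by blast
  have re: "Re (f x) = Re (ip x z)" for x
  proof -
    \<comment> \<open>First-order condition at the minimiser: with constant term 0 the discriminant
      bound forces the linear coefficient to vanish. The inequality holds at \<open>X n\<close> up
      to \<open>1 / Suc n\<close> and is passed to the limit.\<close>
    have "(Re (ip z x) - Re (f x))\<^sup>2 \<le> 0 * Re (ip x x)"
    proof (rule discriminant_le)
      fix t :: real
      define g where "g n = 2 * (Re (ip (X n) x) - Re (f x)) * t + Re (ip x x) * t\<^sup>2
        + 1 / real (Suc n)" for n
      have "0 \<le> g n" for n
      proof -
        have "\<phi> (X n + sc (of_real t) x) = \<phi> (X n) + 2 * (Re (ip (X n) x) - Re (f x)) * t + Re (ip x x) * t\<^sup>2"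
          using Re_ip_commute[of x "X n"]
          by (simp add: \<phi>_def ip_simps f_add f_sc algebra_simps power2_eq_square)
        then show ?thesis using m_le[of "X n + sc (of_real t) x"] X[of n] by (simp add: g_def)
      qed
      moreover have "g \<longlonglongrightarrow> 2 * (Re (ip z x) - Re (f x)) * t + Re (ip x x) * t\<^sup>2 + 0"
        unfolding g_def
        by (intro tendsto_intros cvg_ip z LIMSEQ_inverse_real_of_nat[unfolded inverse_eq_divide])
      ultimately have "0 \<le> 2 * (Re (ip z x) - Re (f x)) * t + Re (ip x x) * t\<^sup>2 + 0"
        by (intro LIMSEQ_le_const) auto
      then show "0 \<le> 0 + 2 * (Re (ip z x) - Re (f x)) * t + Re (ip x x) * t\<^sup>2" by simp
    qed
    then show ?thesis using Re_ip_commute[of x z] by simp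
  qed
  have "f x = ip x z" for x
    using re[of x] re[of "sc \<i> x"] by (simp add: f_sc ip_simps complex_eq_iff)
  then show ?thesis by blast
qed


section \<open>Bounded operators, adjoints and commutants\<close>

lemma bdd_op_clin: "bdd_op sc ip T \<Longrightarrow> clin sc T"
  by (simp add: bdd_op_def)

lemma bdd_opI:
  assumes "clin sc T" "\<And>x. nrm (T x) \<le> k * nrm x"
  shows "bdd_op sc ip T"
  unfolding bdd_op_def
proof (intro conjI exI allI)
  fix x
  have "(nrm (T x))\<^sup>2 \<le> (k * nrm x)\<^sup>2"
    by (rule power_mono[OF assms(2)]) simp
  then show "Re (ip (T x) (T x)) \<le> k\<^sup>2 * Re (ip x x)"
    by (simp add: nrm_sq power_mult_distrib)
qed (rule assms(1))

lemma bdd_opE: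
  assumes "bdd_op sc ip T"
  obtains k where "k > 0" "\<And>x. nrm (T x) \<le> k * nrm x"
proof -
  obtain M where M: "\<And>x. Re (ip (T x) (T x)) \<le> M * Re (ip x x)"
    using assms unfolding bdd_op_def by blast
  \<comment> \<open>The constant \<open>M\<close> could be zero or negative; the maximum with 1
    provides a positive bound.\<close>
  have "nrm (T x) \<le> sqrt (max M 1) * nrm x" for x
  proof -
    have "Re (ip (T x) (T x)) \<le> max M 1 * Re (ip x x)"
      using M[of x] mult_right_mono[OF max.cobounded1[of M 1] ip_nonneg[of x]] by linarith
    then show ?thesis
      unfolding nrm_def real_sqrt_mult[symmetric] by simp
  qed
  then show ?thesis using that[of "sqrt (max M 1)"] by simp
qed

lemma bdd_op_id: "bdd_op sc ip (\<lambda>x. x)"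
  by (rule bdd_opI[of _ 1]) (simp_all add: clin_id)

lemma bdd_op_0: "bdd_op sc ip (\<lambda>x. 0)"
  by (rule bdd_opI[of _ 0]) (simp_all add: clin_def)

lemma bdd_op_add:
  assumes "bdd_op sc ip S" "bdd_op sc ip T"
  shows "bdd_op sc ip (\<lambda>x. S x + T x)"
proof -
  obtain k l where k: "\<And>x. nrm (S x) \<le> k * nrm x" and l: "\<And>x. nrm (T x) \<le> l * nrm x"
    using bdd_opE assms by metis
  show ?thesis
  proof (rule bdd_opI)
    show "clin sc (\<lambda>x. S x + T x)"
      using assms[THEN bdd_op_clin] by (simp add: clin_def vs.scale_right_distrib algebra_simps)
    show "nrm (S x + T x) \<le> (k + l) * nrm x" for x
      using nrm_triangle[of "S x" "T x"] k[of x] l[of x] by (simp add: distrib_right)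
  qed
qed

lemma bdd_op_sc:
  assumes "bdd_op sc ip T"
  shows "bdd_op sc ip (\<lambda>x. sc c (T x))"
proof -
  obtain k where k: "\<And>x. nrm (T x) \<le> k * nrm x"
    using bdd_opE assms by metis
  show ?thesis
  proof (rule bdd_opI)
    show "clin sc (\<lambda>x. sc c (T x))"
      using assms[THEN bdd_op_clin] by (simp add: clin_def vs.scale_right_distrib mult_ac)
    show "nrm (sc c (T x)) \<le> (cmod c * k) * nrm x" for x
      using mult_left_mono[OF k[of x], of "cmod c"] by (simp add: mult_ac)
  qed
qed

lemma bdd_op_minus: "bdd_op sc ip T \<Longrightarrow> bdd_op sc ip (\<lambda>x. - T x)"
  using bdd_op_sc[of T "-1"] by simp

lemma bdd_op_diff: "bdd_op sc ip S \<Longrightarrow> bdd_op sc ip T \<Longrightarrow> bdd_op sc ip (\<lambda>x. S x - T x)"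
  using bdd_op_add[of S "\<lambda>x. - T x"] bdd_op_minus[of T] by simp

lemma bdd_op_comp:
  assumes "bdd_op sc ip S" "bdd_op sc ip T"
  shows "bdd_op sc ip (\<lambda>x. S (T x))"
proof -
  obtain k l where k0: "k > 0" and k: "\<And>x. nrm (S x) \<le> k * nrm x"
    and l: "\<And>x. nrm (T x) \<le> l * nrm x"
    using bdd_opE assms by metis
  show ?thesis
  proof (rule bdd_opI)
    show "clin sc (\<lambda>x. S (T x))"
      using assms[THEN bdd_op_clin] by (simp add: clin_def)
    show "nrm (S (T x)) \<le> (k * l) * nrm x" for x
      using order_trans[OF k[of "T x"] mult_left_mono[OF l[of x], of k]] k0 by (simp add: mult_ac)
  qed
qed

lemmas bdd_op_intros = bdd_op_id bdd_op_0 bdd_op_add bdd_op_sc bdd_op_minus bdd_op_diff bdd_op_comp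

lemma cvg_op:
  assumes "bdd_op sc ip T" "cvg X L"
  shows "cvg (\<lambda>n. T (X n)) (T L)"
proof -
  obtain k where k: "\<And>x. nrm (T x) \<le> k * nrm x"
    using bdd_opE assms by metis
  show ?thesis
  proof (rule cvg_bound)
    show "nrm (T (X n) - T L) \<le> k * nrm (X n - L)" for n
      using k[of "X n - L"] clin_diff[OF bdd_op_clin[OF assms(1)]] by simp
    show "(\<lambda>n. k * nrm (X n - L)) \<longlonglongrightarrow> 0"
      using tendsto_mult_left[OF assms(2)[unfolded cvg_def], of k] by simp
  qed
qed

lemma is_adjoint_sym: "is_adjoint ip S T \<Longrightarrow> is_adjoint ip T S"
  unfolding is_adjoint_def by (metis ip_commute)

lemma is_adjoint_unique: "is_adjoint ip S T \<Longrightarrow> is_adjoint ip S T' \<Longrightarrow> T = T'"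
  unfolding is_adjoint_def by (metis ip_ext ext)

lemma is_adjoint_id: "is_adjoint ip (\<lambda>x. x) (\<lambda>x. x)"
  by (simp add: is_adjoint_def)

lemma is_adjoint_add:
  "is_adjoint ip S S' \<Longrightarrow> is_adjoint ip T T' \<Longrightarrow> is_adjoint ip (\<lambda>x. S x + T x) (\<lambda>x. S' x + T' x)"
  by (simp add: is_adjoint_def ip_simps)

lemma is_adjoint_diff:
  "is_adjoint ip S S' \<Longrightarrow> is_adjoint ip T T' \<Longrightarrow> is_adjoint ip (\<lambda>x. S x - T x) (\<lambda>x. S' x - T' x)"
  by (simp add: is_adjoint_def ip_simps)

lemma is_adjoint_sc: "is_adjoint ip T T' \<Longrightarrow> is_adjoint ip (\<lambda>x. sc c (T x)) (\<lambda>x. sc (cnj c) (T' x))"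
  by (simp add: is_adjoint_def ip_simps)

lemma is_adjoint_comp:
  "is_adjoint ip S S' \<Longrightarrow> is_adjoint ip T T' \<Longrightarrow> is_adjoint ip (\<lambda>x. S (T x)) (\<lambda>x. T' (S' x))"
  by (simp add: is_adjoint_def)

text \<open>For fixed \<open>y\<close>, the vector \<open>S y\<close> is the Riesz vector of the
  bounded functional sending \<open>x\<close> to \<open>ip (T x) y\<close>.\<close>

lemma adjoint_exists:
  assumes "bdd_op sc ip T"
  shows "\<exists>S. is_adjoint ip T S \<and> bdd_op sc ip S"
proof -
  obtain k where k0: "k > 0" and k: "\<And>x. nrm (T x) \<le> k * nrm x"
    using bdd_opE assms by metis
  note T = clin_simps[OF bdd_op_clin[OF assms]]
  have "\<exists>z. \<forall>x. ip (T x) y = ip x z" for y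
  proof (rule riesz)
    fix x
    show "cmod (ip (T x) y) \<le> (2 * k * nrm y) * nrm x"
      using cmod_ip_le[of "T x" y] mult_right_mono[OF k[of x], of "nrm y"] by (simp add: mult_ac)
  qed (simp_all add: T ip_simps)
  then obtain S where S: "\<And>x y. ip (T x) y = ip x (S y)" by metis
  have "clin sc S"
    unfolding clin_def
  proof (intro conjI allI)
    show "S (x + y) = S x + S y" for x y
      by (rule ip_ext) (simp add: ip_add_right flip: S)
    show "S (sc c x) = sc c (S x)" for c x
      by (rule ip_ext) (simp add: ip_sc_right flip: S)
  qed
  moreover have "nrm (S y) \<le> k * nrm y" for y
  proof (cases "S y = 0")
    case False
    then have pos: "nrm (S y) > 0" using nrm_ge_0[of "S y"] nrm_eq_0[of "S y"] by linarith
    have "(nrm (S y))\<^sup>2 = Re (ip (T (S y)) y)" by (simp add: nrm_sq S)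
    also have "\<dots> \<le> nrm (T (S y)) * nrm y" using cauchy_schwarz_Re[of "T (S y)" y] by linarith
    also have "\<dots> \<le> k * nrm (S y) * nrm y" by (rule mult_right_mono[OF k]) simp
    finally have "nrm (S y) * nrm (S y) \<le> nrm (S y) * (k * nrm y)"
      by (simp add: power2_eq_square mult_ac)
    then show ?thesis using pos by simp
  qed (use k0 in simp)
  ultimately have "bdd_op sc ip S" by (rule bdd_opI)
  then show ?thesis using S unfolding is_adjoint_def by blast
qed

lemma is_adjoint_adjoint: "bdd_op sc ip T \<Longrightarrow> is_adjoint ip T (adjoint ip T)"
  unfolding adjoint_def using adjoint_exists someI_ex[of "is_adjoint ip T"] by blast

section \<open>Commutants\<close>

lemma commutantI:
  "bdd_op sc ip A \<Longrightarrow> (\<And>X x. X \<in> F \<Longrightarrow> A (X x) = X (A x)) \<Longrightarrow> A \<in> commutant sc ip F"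
  by (auto simp: commutant_def)

lemma commutant_bdd: "A \<in> commutant sc ip F \<Longrightarrow> bdd_op sc ip A"
  by (simp add: commutant_def)

lemma commutant_eq: "A \<in> commutant sc ip F \<Longrightarrow> X \<in> F \<Longrightarrow> A (X x) = X (A x)"
  unfolding commutant_def by (auto dest!: bspec simp: fun_eq_iff)

lemma commutant_antimono: "F \<subseteq> G \<Longrightarrow> commutant sc ip G \<subseteq> commutant sc ip F"
  by (auto simp: commutant_def)

lemma subset_bicommutant:
  "(\<And>A. A \<in> F \<Longrightarrow> bdd_op sc ip A) \<Longrightarrow> F \<subseteq> commutant sc ip (commutant sc ip F)"
  by (auto simp: commutant_def)

text \<open>One inclusion is the commutant of \<open>F \<subseteq> F''\<close>, the other is the
  same fact for the commutant of \<open>F\<close>.\<close>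

lemma commutant3:
  assumes "\<And>A. A \<in> F \<Longrightarrow> bdd_op sc ip A"
  shows "commutant sc ip (commutant sc ip (commutant sc ip F)) = commutant sc ip F"
proof
  show "commutant sc ip (commutant sc ip (commutant sc ip F)) \<subseteq> commutant sc ip F"
    by (intro commutant_antimono subset_bicommutant assms)
  show "commutant sc ip F \<subseteq> commutant sc ip (commutant sc ip (commutant sc ip F))"
    by (intro subset_bicommutant commutant_bdd)
qed

context
  fixes F assumes F: "\<And>X. X \<in> F \<Longrightarrow> clin sc X"
begin

lemma commutant_id: "(\<lambda>x. x) \<in> commutant sc ip F"
  by (rule commutantI) (simp_all add: bdd_op_id)

lemma commutant_add:
  "S \<in> commutant sc ip F \<Longrightarrow> T \<in> commutant sc ip F \<Longrightarrow> (\<lambda>x. S x + T x) \<in> commutant sc ip F"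
  by (rule commutantI) (simp_all add: bdd_op_intros commutant_bdd commutant_eq clin_simps F)

lemma commutant_diff:
  "S \<in> commutant sc ip F \<Longrightarrow> T \<in> commutant sc ip F \<Longrightarrow> (\<lambda>x. S x - T x) \<in> commutant sc ip F"
  by (rule commutantI) (simp_all add: bdd_op_intros commutant_bdd commutant_eq clin_simps F)

lemma commutant_sc: "T \<in> commutant sc ip F \<Longrightarrow> (\<lambda>x. sc c (T x)) \<in> commutant sc ip F"
  by (rule commutantI) (simp_all add: bdd_op_intros commutant_bdd commutant_eq clin_simps F)

lemma commutant_comp:
  "S \<in> commutant sc ip F \<Longrightarrow> T \<in> commutant sc ip F \<Longrightarrow> (\<lambda>x. S (T x)) \<in> commutant sc ip F"
  by (rule commutantI) (simp_all add: bdd_op_intros commutant_bdd commutant_eq)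

end

text \<open>Taking adjoints in \<open>A X' = X' A\<close> gives the relation between
  \<open>A'\<close> and \<open>X\<close>.\<close>

lemma commutant_adjoint_closed:
  assumes F: "\<And>X. X \<in> F \<Longrightarrow> \<exists>X'\<in>F. is_adjoint ip X X'"
    and A: "A \<in> commutant sc ip F" and adj: "is_adjoint ip A A'"
  shows "A' \<in> commutant sc ip F"
proof (rule commutantI)
  show "bdd_op sc ip A'"
    using adjoint_exists[OF commutant_bdd[OF A]] is_adjoint_unique adj by metis
  fix X x assume X: "X \<in> F"
  then obtain X' where X': "X' \<in> F" "is_adjoint ip X X'" using F by blast
  show "A' (X x) = X (A' x)"
  proof (rule ip_ext)
    fix z
    have "ip z (A' (X x)) = ip (X' (A z)) x"
      using adj is_adjoint_sym[OF X'(2)] by (simp add: is_adjoint_def)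
    also have "\<dots> = ip (A (X' z)) x" by (simp add: commutant_eq[OF A X'(1)])
    also have "\<dots> = ip z (X (A' x))"
      using adj is_adjoint_sym[OF X'(2)] by (simp add: is_adjoint_def)
    finally show "ip z (A' (X x)) = ip z (X (A' x))" .
  qed
qed

lemma commutant_adjoint_ex:
  assumes "\<And>X. X \<in> F \<Longrightarrow> \<exists>X'\<in>F. is_adjoint ip X X'" and "A \<in> commutant sc ip F"
  shows "\<exists>A'\<in>commutant sc ip F. is_adjoint ip A A'"
  using adjoint_exists[OF commutant_bdd[OF assms(2)]] commutant_adjoint_closed[OF assms] by blast

lemma selfadj_bdd: "selfadj sc ip T \<Longrightarrow> bdd_op sc ip T"
  and selfadj_adj: "selfadj sc ip T \<Longrightarrow> is_adjoint ip T T"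
  and selfadj_clin: "selfadj sc ip T \<Longrightarrow> clin sc T"
  and selfadj_ip: "selfadj sc ip T \<Longrightarrow> ip (T x) y = ip x (T y)"
  by (auto simp: selfadj_def is_adjoint_def intro: bdd_op_clin)

text \<open>Since \<open>vN_alg\<close> demands equality with the bicommutant, monotonicity of the
  double commutant puts that of \<open>F\<close> inside every competitor. It is itself a competitor:
  self-adjoint generators make both commutants closed under adjoints.\<close>

lemma Wstar_eq_bicommutant:
  assumes F: "\<And>X. X \<in> F \<Longrightarrow> selfadj sc ip X"
  shows "Wstar sc ip F = commutant sc ip (commutant sc ip F)" (is "_ = ?R")
proof
  have star: "\<exists>X'\<in>F. is_adjoint ip X X'" if "X \<in> F" for X
    using F[OF that] that selfadj_adj by blast
  have "vN_alg sc ip ?R"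
    unfolding vN_alg_def
  proof (intro conjI ballI)
    fix A assume A: "A \<in> ?R"
    show "bdd_op sc ip A" using A by (rule commutant_bdd)
    then show "adjoint ip A \<in> ?R"
      using commutant_adjoint_closed[OF commutant_adjoint_ex[OF star] A] is_adjoint_adjoint by blast
  next
    show "commutant sc ip (commutant sc ip ?R) = ?R"
      by (rule commutant3) (rule commutant_bdd)
  qed
  moreover have "F \<subseteq> ?R" by (rule subset_bicommutant) (rule selfadj_bdd[OF F])
  ultimately show "Wstar sc ip F \<subseteq> ?R" unfolding Wstar_def by blast
  show "?R \<subseteq> Wstar sc ip F"
    unfolding Wstar_def
  proof (rule Inter_greatest)
    fix R assume "R \<in> {R. vN_alg sc ip R \<and> F \<subseteq> R}"
    then have R: "commutant sc ip (commutant sc ip R) = R" "F \<subseteq> R" by (auto simp: vN_alg_def)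
    show "?R \<subseteq> R" using commutant_antimono[OF commutant_antimono[OF R(2)]] R(1) by simp
  qed
qed

end

section \<open>Square roots of positive operators\<close>

text \<open>
  The root of \<open>1 - C\<close> is \<open>1 - Y\<close>, where \<open>Y\<close> is the limit of the iteration \<open>Y \<mapsto> (C + Y\<^sup>2)/2\<close> started
  at 0. The same iteration for the scalar \<open>C = 1\<close> is a majorant: it bounds both the norms
  of the iterates and the norms of their increments.
\<close>

primrec sqrt_bound :: "nat \<Rightarrow> real" where
  "sqrt_bound 0 = 0"
| "sqrt_bound (Suc n) = (1 + (sqrt_bound n)\<^sup>2) / 2"

lemma sqrt_bound_nonneg: "0 \<le> sqrt_bound n"
  by (induction n) simp_all

lemma sqrt_bound_le_1: "sqrt_bound n \<le> 1"
proof (induction n)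
  case (Suc n)
  then have "(sqrt_bound n)\<^sup>2 \<le> 1" by (simp add: power_le_one sqrt_bound_nonneg)
  then show ?case by simp
qed simp

lemma sqrt_bound_mono: "sqrt_bound n \<le> sqrt_bound (Suc n)"
proof -
  have "0 \<le> (1 - sqrt_bound n)\<^sup>2" by simp
  then show ?thesis by (simp add: power2_diff)
qed

lemma convergent_sqrt_bound: "convergent sqrt_bound"
proof (rule Bseq_monoseq_convergent)
  show "Bseq sqrt_bound"
    by (rule BseqI'[of _ 1]) (simp add: sqrt_bound_nonneg sqrt_bound_le_1)
  show "monoseq sqrt_bound" by (simp add: monoseq_Suc sqrt_bound_mono del: sqrt_bound.simps)
qed

context hspace
begin

lemma selfadjI: "bdd_op sc ip T \<Longrightarrow> is_adjoint ip T T \<Longrightarrow> selfadj sc ip T"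
  by (simp add: selfadj_def)

lemma selfadj_id: "selfadj sc ip (\<lambda>x. x)"
  by (simp add: selfadj_def bdd_op_id is_adjoint_id)

lemma selfadj_add: "selfadj sc ip S \<Longrightarrow> selfadj sc ip T \<Longrightarrow> selfadj sc ip (\<lambda>x. S x + T x)"
  by (simp add: selfadj_def bdd_op_add is_adjoint_add)

lemma selfadj_diff: "selfadj sc ip S \<Longrightarrow> selfadj sc ip T \<Longrightarrow> selfadj sc ip (\<lambda>x. S x - T x)"
  by (simp add: selfadj_def bdd_op_diff is_adjoint_diff)

lemma selfadj_sc: "selfadj sc ip T \<Longrightarrow> selfadj sc ip (\<lambda>x. sc (of_real r) (T x))"
  using is_adjoint_sc[of T T "of_real r"] by (simp add: selfadj_def bdd_op_sc)

lemma selfadj_comp: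
  assumes "selfadj sc ip S" "selfadj sc ip T" "\<And>x. S (T x) = T (S x)"
  shows "selfadj sc ip (\<lambda>x. S (T x))"
  using assms is_adjoint_comp[of S S T T] by (simp add: selfadj_def bdd_op_comp)

lemma positive_opD:
  assumes "positive_op sc ip A"
  shows "selfadj sc ip A" "0 \<le> Re (ip (A x) x)"
  using assms by (auto simp: positive_op_def)

text \<open>The form inequality at the vectors \<open>x\<close> and \<open>A x\<close> bounds
  \<open>nrm (A x) ^ 4\<close> by \<open>d^2 * nrm x ^ 2 * nrm (A x) ^ 2\<close>, from which the
  norm bound follows with the same constant \<open>d\<close>.\<close>

lemma positive_bound:
  assumes A: "positive_op sc ip A" and d: "\<And>x. Re (ip (A x) x) \<le> d * (nrm x)\<^sup>2"
  shows "nrm (A x) \<le> d * nrm x"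
proof (cases "A x = 0")
  case True
  have "0 \<le> d * (nrm x)\<^sup>2" using positive_opD(2)[OF A, of x] d[of x] by linarith
  then have "0 \<le> d * nrm x"
    using zero_le_mult_iff[of d "nrm x"] zero_le_mult_iff[of d "(nrm x)\<^sup>2"] by auto
  then show ?thesis using True by simp
next
  case False
  then have pos: "nrm (A x) > 0" using nrm_ge_0[of "A x"] nrm_eq_0[of "A x"] by linarith
  have "0 < nrm x"
    using False clin_0[OF selfadj_clin[OF positive_opD(1)[OF A]]] nrm_ge_0[of x] nrm_eq_0[of x]
    by (metis less_eq_real_def)
  have d0: "0 \<le> d * (nrm y)\<^sup>2" for y using positive_opD(2)[OF A, of y] d[of y] by linarith
  then have dn: "0 \<le> d" using \<open>0 < nrm x\<close> by (metis zero_le_mult_iff linorder_not_le zero_less_power)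
  have "(Re (ip (A x) (A x)))\<^sup>2 \<le> Re (ip (A x) x) * Re (ip (A (A x)) (A x))"
    using positive_opD[OF A] by (intro form_cauchy_schwarz) (simp_all add: selfadj_clin selfadj_adj)
  also have "\<dots> \<le> (d * (nrm x)\<^sup>2) * (d * (nrm (A x))\<^sup>2)"
    by (intro mult_mono d d0 positive_opD(2)[OF A])
  finally have "((nrm (A x))\<^sup>2)\<^sup>2 \<le> (d * nrm x * nrm (A x))\<^sup>2"
    unfolding nrm_sq[of "A x", symmetric] by (simp add: power_mult_distrib mult_ac power2_eq_square)
  then have "(nrm (A x))\<^sup>2 \<le> d * nrm x * nrm (A x)"
    by (rule power2_le_imp_le) (use dn in simp)
  then show ?thesis using pos by (simp add: power2_eq_square)
qed

primrec sqrt_iter :: "('a \<Rightarrow> 'a) \<Rightarrow> nat \<Rightarrow> 'a \<Rightarrow> 'a" where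
  "sqrt_iter C 0 = (\<lambda>x. 0)"
| "sqrt_iter C (Suc n) = (\<lambda>x. sc (1/2) (C x + sqrt_iter C n (sqrt_iter C n x)))"

text \<open>The equation for \<open>Y\<close> says \<open>(1 - Y)^2 = 1 - C\<close>. The commutant
  inclusion holds for the iterates, which are polynomials in \<open>C\<close>, and survives the
  limit.\<close>

lemma sqrt_contraction:
  assumes C: "selfadj sc ip C" and C1: "\<And>x. nrm (C x) \<le> nrm x"
  shows "\<exists>Y. selfadj sc ip Y \<and> (\<forall>x. nrm (Y x) \<le> nrm x) \<and> (\<forall>x. sc 2 (Y x) = C x + Y (Y x))
    \<and> commutant sc ip {C} \<subseteq> commutant sc ip {Y}"
proof -
  let ?Y = "sqrt_iter C"
  have bdd: "bdd_op sc ip (?Y n)" for n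
    by (induction n) (simp_all add: bdd_op_intros selfadj_bdd[OF C])
  note lin = clin_simps[OF bdd_op_clin[OF bdd]]
  have comm: "X (?Y n x) = ?Y n (X x)" if X: "bdd_op sc ip X" "\<And>x. X (C x) = C (X x)" for X n x
    by (induction n arbitrary: x) (simp_all add: clin_simps[OF bdd_op_clin[OF X(1)]] X(2))
  have commY: "?Y m (?Y n x) = ?Y n (?Y m x)" for m n x
    using comm[OF bdd comm[OF selfadj_bdd[OF C], symmetric]] by simp
  have adj: "is_adjoint ip (?Y n) (?Y n)" for n
  proof (induction n)
    case (Suc n)
    then show ?case
      using is_adjoint_sc[OF is_adjoint_add[OF selfadj_adj[OF C] is_adjoint_comp[OF Suc Suc]], of "1/2"]
      by simp
  qed (simp add: is_adjoint_def)
  have bound: "nrm (?Y n x) \<le> sqrt_bound n * nrm x" for n x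
  proof (induction n arbitrary: x)
    case (Suc n)
    have "nrm (?Y n (?Y n x)) \<le> sqrt_bound n * (sqrt_bound n * nrm x)"
      using order_trans[OF Suc mult_left_mono[OF Suc sqrt_bound_nonneg]] .
    then have "nrm (C x + ?Y n (?Y n x)) \<le> nrm x + (sqrt_bound n)\<^sup>2 * nrm x"
      using nrm_triangle[of "C x" "?Y n (?Y n x)"] C1[of x] by (simp add: power2_eq_square)
    moreover have "nrm (?Y (Suc n) x) = nrm (C x + ?Y n (?Y n x)) / 2" by simp
    ultimately show ?case by (simp add: distrib_right del: sqrt_iter.simps)
  qed simp
  have step: "nrm (?Y (Suc n) x - ?Y n x) \<le> (sqrt_bound (Suc n) - sqrt_bound n) * nrm x" for n x
  proof (induction n arbitrary: x)
    case 0
    then show ?case using C1[of x] by simp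
  next
    case (Suc n)
    define Dx where "Dx = ?Y (Suc n) x - ?Y n x"
    let ?b = "sqrt_bound"
    have "?Y (Suc (Suc n)) x - ?Y (Suc n) x
      = sc (1/2) (C x + ?Y (Suc n) (?Y (Suc n) x)) - sc (1/2) (C x + ?Y n (?Y n x))"
      by simp
    also have "\<dots> = sc (1/2) (?Y (Suc n) (?Y (Suc n) x) - ?Y n (?Y n x))"
      by (simp add: vs.scale_right_distrib vs.scale_right_diff_distrib del: sqrt_iter.simps)
    \<comment> \<open>The iterates commute, so a difference of squares factors into sum times
      difference. The scalar sequence \<open>?b\<close> factors in the same way, which is why it
      dominates the increments.\<close>
    also have "?Y (Suc n) (?Y (Suc n) x) - ?Y n (?Y n x) = ?Y (Suc n) Dx + ?Y n Dx"
      using commY[of "Suc n" n x] by (simp add: Dx_def lin del: sqrt_iter.simps)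
    finally have eq: "?Y (Suc (Suc n)) x - ?Y (Suc n) x = sc (1/2) (?Y (Suc n) Dx + ?Y n Dx)" .
    have "nrm (?Y (Suc n) Dx + ?Y n Dx) \<le> (?b (Suc n) + ?b n) * nrm Dx"
      using nrm_triangle[of "?Y (Suc n) Dx" "?Y n Dx"] bound[of "Suc n" Dx] bound[of n Dx]
      by (simp add: distrib_right del: sqrt_iter.simps sqrt_bound.simps)
    also have "\<dots> \<le> (?b (Suc n) + ?b n) * ((?b (Suc n) - ?b n) * nrm x)"
      using Suc[of x] sqrt_bound_nonneg
      by (intro mult_left_mono) (simp_all add: Dx_def add_nonneg_nonneg del: sqrt_iter.simps sqrt_bound.simps)
    also have "\<dots> = 2 * ((?b (Suc (Suc n)) - ?b (Suc n)) * nrm x)"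
    proof -
      have "(?b (Suc n) + ?b n) * (?b (Suc n) - ?b n) = 2 * (?b (Suc (Suc n)) - ?b (Suc n))"
        unfolding sqrt_bound.simps(2)[of "Suc n"] sqrt_bound.simps(2)[of n]
        by (simp add: power2_eq_square field_simps)
      then show ?thesis by (metis mult.assoc)
    qed
    finally show ?case unfolding eq by simp
  qed
  have diff: "nrm (?Y (n + k) x - ?Y n x) \<le> (sqrt_bound (n + k) - sqrt_bound n) * nrm x" for n k x
  proof (induction k)
    case (Suc k)
    have "?Y (n + Suc k) x - ?Y n x = (?Y (Suc (n + k)) x - ?Y (n + k) x) + (?Y (n + k) x - ?Y n x)"
      by (simp del: sqrt_iter.simps)
    then have "nrm (?Y (n + Suc k) x - ?Y n x)
      \<le> nrm (?Y (Suc (n + k)) x - ?Y (n + k) x) + nrm (?Y (n + k) x - ?Y n x)"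
      using nrm_triangle by metis
    also have "\<dots> \<le> (sqrt_bound (n + Suc k) - sqrt_bound n) * nrm x"
      using Suc step[of "n + k" x] by (simp add: algebra_simps del: sqrt_iter.simps sqrt_bound.simps)
    finally show ?case .
  qed simp
  have "\<exists>L. cvg (\<lambda>n. ?Y n x) L" for x
  proof (rule complete_cvg)
    fix e :: real assume e: "e > 0"
    \<comment> \<open>Adding 1 avoids a division by zero at \<open>x = 0\<close>.\<close>
    define r where "r = e / (nrm x + 1)"
    have "0 < nrm x + 1" using nrm_ge_0[of x] by linarith
    then have r: "r > 0" "r * nrm x < e" using e by (simp_all add: r_def field_simps)
    obtain N where N: "\<And>m n. m \<ge> N \<Longrightarrow> n \<ge> N \<Longrightarrow> \<bar>sqrt_bound m - sqrt_bound n\<bar> < r"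
      using convergent_Cauchy[OF convergent_sqrt_bound] r(1) unfolding Cauchy_def dist_real_def by metis
    have le: "nrm (?Y m x - ?Y n x) < e" if "m \<ge> n" "n \<ge> N" for m n
    proof -
      have "nrm (?Y m x - ?Y n x) \<le> (sqrt_bound m - sqrt_bound n) * nrm x"
        using diff[of n "m - n" x] that by simp
      also have "\<dots> \<le> r * nrm x"
        using N[of m n] that by (intro mult_right_mono) auto
      finally show ?thesis using r(2) by linarith
    qed
    have "nrm (?Y m x - ?Y n x) < e" if "m \<ge> N" "n \<ge> N" for m n
      using le[of m n] le[of n m] that nrm_minus_commute by (metis nle_le)
    then show "\<exists>N. \<forall>m\<ge>N. \<forall>n\<ge>N. nrm (?Y m x - ?Y n x) < e" by blast
  qed
  then obtain Y where Y: "\<And>x. cvg (\<lambda>n. ?Y n x) (Y x)" by metis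
  have Y_lin: "clin sc Y"
    unfolding clin_def
  proof (intro conjI allI)
    fix x y c
    show "Y (x + y) = Y x + Y y"
      using cvg_unique[OF Y cvg_add[OF Y Y, folded lin(2)]] .
    show "Y (sc c x) = sc c (Y x)"
      using cvg_unique[OF Y cvg_sc[OF Y, folded lin(3)]] .
  qed
  have bound1: "nrm (?Y n x) \<le> nrm x" for n x
    using bound[of n x] mult_right_mono[OF sqrt_bound_le_1[of n] nrm_ge_0[of x]] by simp
  have Y1: "nrm (Y x) \<le> nrm x" for x
    using cvg_nrm_le[OF Y bound1] .
  have Y_bdd: "bdd_op sc ip Y" by (rule bdd_opI[of _ 1]) (simp_all add: Y_lin Y1)
  have Y_adj: "is_adjoint ip Y Y"
    unfolding is_adjoint_def
  proof (intro allI)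
    fix x y
    have "(\<lambda>n. ip (?Y n x) y) \<longlonglongrightarrow> ip (Y x) y" by (rule cvg_ip[OF Y])
    moreover have "(\<lambda>n. cnj (ip (?Y n y) x)) \<longlonglongrightarrow> cnj (ip (Y y) x)"
      by (intro tendsto_cnj cvg_ip[OF Y])
    moreover have "cnj (ip (?Y n y) x) = ip (?Y n x) y" for n
      using adj[of n] unfolding is_adjoint_def by (metis ip_commute)
    ultimately have "ip (Y x) y = cnj (ip (Y y) x)" using LIMSEQ_unique by simp
    then show "ip (Y x) y = ip x (Y y)" by (metis ip_commute)
  qed
  \<comment> \<open>Operator and argument both vary with \<open>n\<close>: the uniform bound
    \<open>bound1\<close> controls one part of the difference, convergence at the fixed vector
    \<open>Y x\<close> the other.\<close>
  have Y2: "cvg (\<lambda>n. ?Y n (?Y n x)) (Y (Y x))" for x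
  proof (rule cvg_bound)
    fix n
    have "?Y n (?Y n x) - Y (Y x) = ?Y n (?Y n x - Y x) + (?Y n (Y x) - Y (Y x))"
      by (simp add: lin)
    then have "nrm (?Y n (?Y n x) - Y (Y x)) \<le> nrm (?Y n (?Y n x - Y x)) + nrm (?Y n (Y x) - Y (Y x))"
      using nrm_triangle by metis
    then show "nrm (?Y n (?Y n x) - Y (Y x)) \<le> nrm (?Y n x - Y x) + nrm (?Y n (Y x) - Y (Y x))"
      using bound1[of n "?Y n x - Y x"] by linarith
    show "(\<lambda>n. nrm (?Y n x - Y x) + nrm (?Y n (Y x) - Y (Y x))) \<longlonglongrightarrow> 0"
      using tendsto_add[OF Y[of x, unfolded cvg_def] Y[of "Y x", unfolded cvg_def]] by simp
  qed
  have "sc 2 (Y x) = C x + Y (Y x)" for x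
  proof -
    have "cvg (\<lambda>n. ?Y (Suc n) x) (sc (1/2) (C x + Y (Y x)))"
      unfolding sqrt_iter.simps by (intro cvg_sc cvg_add cvg_const Y2)
    moreover have "cvg (\<lambda>n. ?Y (Suc n) x) (Y x)"
      using Y[of x] unfolding cvg_def by (rule LIMSEQ_Suc)
    ultimately have "Y x = sc (1/2) (C x + Y (Y x))" by (intro cvg_unique)
    then have "sc 2 (Y x) = sc 2 (sc (1/2) (C x + Y (Y x)))" by simp
    then show ?thesis by (simp del: vs.scale_right_distrib)
  qed
  moreover have "commutant sc ip {C} \<subseteq> commutant sc ip {Y}"
  proof
    fix X assume X: "X \<in> commutant sc ip {C}"
    note Xb = commutant_bdd[OF X]
    show "X \<in> commutant sc ip {Y}"
    proof (rule commutantI[OF Xb])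
      fix Z x assume "Z \<in> {Y}"
      have "cvg (\<lambda>n. ?Y n (X x)) (X (Y x))"
        using cvg_op[OF Xb Y[of x]] comm[OF Xb commutant_eq[OF X]] by simp
      then show "X (Z x) = Z (X x)" using cvg_unique[OF _ Y] \<open>Z \<in> {Y}\<close> by blast
    qed
  qed
  ultimately show ?thesis using Y1 selfadjI[OF Y_bdd Y_adj] by blast
qed

text \<open>Dividing by a norm bound \<open>k\<close> makes \<open>C = 1 - A/k\<close> a positive
  contraction. If \<open>Y\<close> is the operator from \<open>sqrt_contraction\<close>, then
  \<open>k (1 - Y)^2 = k (1 - C) = A\<close>, so \<open>R\<close> is \<open>sqrt k\<close> times
  \<open>1 - Y\<close>.\<close>

lemma sqrt_exists:
  assumes A: "positive_op sc ip A"
  shows "\<exists>R. positive_op sc ip R \<and> (\<forall>x. R (R x) = A x) \<and> commutant sc ip {A} \<subseteq> commutant sc ip {R}"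
proof -
  note As = positive_opD(1)[OF A]
  obtain k where k0: "k > 0" and k: "\<And>x. nrm (A x) \<le> k * nrm x"
    using bdd_opE[OF selfadj_bdd[OF As]] by metis
  define C where "C = (\<lambda>x. x - sc (of_real (1/k)) (A x))"
  have C: "selfadj sc ip C" unfolding C_def by (intro selfadj_id selfadj_diff selfadj_sc As)
  have ipC: "Re (ip (C x) x) = (nrm x)\<^sup>2 - Re (ip (A x) x) / k" for x
    by (simp add: C_def ip_simps nrm_sq)
  have Ale: "Re (ip (A x) x) \<le> k * (nrm x)\<^sup>2" for x
    using cauchy_schwarz_Re[of "A x" x] mult_right_mono[OF k[of x], of "nrm x"]
    by (simp add: power2_eq_square)
  have "positive_op sc ip C"
    unfolding positive_op_def ipC using C Ale k0 by (auto simp: field_simps)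
  then have C1: "nrm (C x) \<le> nrm x" for x
    using positive_bound[of C 1 x] positive_opD(2)[OF A] k0 unfolding ipC by simp
  obtain Y where Y: "selfadj sc ip Y" "\<And>x. nrm (Y x) \<le> nrm x" "\<And>x. sc 2 (Y x) = C x + Y (Y x)"
    "commutant sc ip {C} \<subseteq> commutant sc ip {Y}"
    using sqrt_contraction[OF C C1] by blast
  define R where "R = (\<lambda>x. sc (of_real (sqrt k)) (x - Y x))"
  have Rs: "selfadj sc ip R"
    unfolding R_def by (intro selfadj_id selfadj_diff selfadj_sc Y)
  have "positive_op sc ip R"
    unfolding positive_op_def
  proof (intro conjI allI Rs)
    fix x
    have "Re (ip (Y x) x) \<le> (nrm x)\<^sup>2"
      using cauchy_schwarz_Re[of "Y x" x] mult_right_mono[OF Y(2)[of x], of "nrm x"]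
      by (simp add: power2_eq_square)
    then show "0 \<le> Re (ip (R x) x)"
      using k0 by (simp add: R_def ip_simps nrm_sq zero_le_mult_iff)
  qed
  moreover have "R (R x) = A x" for x
  proof (rule ip_ext)
    fix z
    have "ip z (sc 2 (Y x)) = ip z (C x + Y (Y x))" by (simp only: Y(3))
    then have eq: "ip z (Y (Y x)) = 2 * ip z (Y x) - ip z (C x)" by (simp add: ip_simps)
    have kk: "complex_of_real (sqrt k) * complex_of_real (sqrt k) = of_real k"
      using k0 by (simp flip: of_real_mult)
    then have kk': "complex_of_real (sqrt k) * (complex_of_real (sqrt k) * w) = of_real k * w" for w
      by (metis mult.assoc)
    then show "ip z (R (R x)) = ip z (A x)"
      using k0 by (simp add: R_def clin_simps[OF selfadj_clin[OF Y(1)]] ip_simps eq)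
        (simp add: C_def ip_simps right_diff_distrib kk')
  qed
  moreover have "commutant sc ip {A} \<subseteq> commutant sc ip {R}"
  proof
    fix X assume X: "X \<in> commutant sc ip {A}"
    note lin = clin_simps[OF bdd_op_clin[OF commutant_bdd[OF X]]]
    have "X \<in> commutant sc ip {C}"
      by (rule commutantI[OF commutant_bdd[OF X]]) (auto simp: C_def lin commutant_eq[OF X])
    then have "X \<in> commutant sc ip {Y}" using Y(4) by blast
    then have "X (Y x) = Y (X x)" for x by (rule commutant_eq) simp
    then show "X \<in> commutant sc ip {R}"
      by (intro commutantI commutant_bdd[OF X]) (auto simp: R_def lin)
  qed
  ultimately show ?thesis by blast
qed

lemma positive_ip_zero:
  assumes "positive_op sc ip A" "Re (ip (A x) x) = 0"
  shows "A x = 0"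
proof -
  have "(Re (ip (A x) (A x)))\<^sup>2 \<le> Re (ip (A x) x) * Re (ip (A (A x)) (A x))"
    using positive_opD[OF assms(1)] by (intro form_cauchy_schwarz) (simp_all add: selfadj_clin selfadj_adj)
  then have "nrm (A x) = 0" using assms(2) by (simp add: nrm_def)
  then show ?thesis by simp
qed

text \<open>For \<open>y = (B - R) x\<close> one has \<open>(B + R) y = (B^2 - R^2) x = 0\<close>.
  Both forms are nonnegative, so both vanish at \<open>y\<close>; hence \<open>B y = R y = 0\<close>
  and \<open>ip y y = ip x ((B - R) y) = 0\<close>.\<close>

lemma sqrt_unique:
  assumes B: "positive_op sc ip B" and R: "positive_op sc ip R"
    and eq: "\<And>x. R (R x) = B (B x)" and comm: "\<And>x. R (B x) = B (R x)"
  shows "R = B"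
proof
  fix x
  note linB = clin_simps[OF selfadj_clin[OF positive_opD(1)[OF B]]]
  note linR = clin_simps[OF selfadj_clin[OF positive_opD(1)[OF R]]]
  define y where "y = B x - R x"
  have sum0: "B y + R y = 0" by (simp add: y_def linB linR eq comm)
  have "Re (ip (B y) y) + Re (ip (R y) y) = 0"
    using arg_cong[OF sum0, of "\<lambda>v. Re (ip v y)"] by (simp add: ip_add_left)
  then have "Re (ip (B y) y) = 0" "Re (ip (R y) y) = 0"
    using positive_opD(2)[OF B, of y] positive_opD(2)[OF R, of y] by linarith+
  then have "B y = 0" "R y = 0" using positive_ip_zero B R by blast+
  have "ip y y = ip x (B y - R y)"
    using selfadj_ip[OF positive_opD(1)[OF B]] selfadj_ip[OF positive_opD(1)[OF R]]
    by (simp add: y_def ip_diff_left ip_diff_right linB linR)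
  then have "ip y y = 0" using \<open>B y = 0\<close> \<open>R y = 0\<close> by simp
  then show "R x = B x" using ip_eq_zero[of y] by (simp add: y_def)
qed

text \<open>By uniqueness, \<open>B\<close> is the root of \<open>B^2\<close> that
  \<open>sqrt_exists\<close> constructs, and that root commutes with everything commuting with
  \<open>B^2\<close>.\<close>

lemma commutant_square:
  assumes B: "positive_op sc ip B"
  shows "commutant sc ip {\<lambda>x. B (B x)} \<subseteq> commutant sc ip {B}"
proof -
  note Bs = positive_opD(1)[OF B]
  have "positive_op sc ip (\<lambda>x. B (B x))"
    unfolding positive_op_def using selfadj_comp[OF Bs Bs] by (simp add: selfadj_ip[OF Bs, of "B _"] ip_nonneg)
  then obtain R where R: "positive_op sc ip R" "\<And>x. R (R x) = B (B x)"
    "commutant sc ip {\<lambda>x. B (B x)} \<subseteq> commutant sc ip {R}"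
    using sqrt_exists by blast
  have "B \<in> commutant sc ip {\<lambda>x. B (B x)}"
    by (rule commutantI) (auto simp: selfadj_bdd[OF Bs])
  then have "B (R x) = R (B x)" for x using R(3) commutant_eq by blast
  then have "R = B" by (intro sqrt_unique[OF B R(1,2)]) (rule sym)
  then show ?thesis using R(3) by simp
qed


section \<open>Inverses and unitaries\<close>

lemma positive_diff_squares:
  assumes B: "positive_op sc ip B" and d: "\<And>x. Re (ip (B x) x) \<le> d * (nrm x)\<^sup>2"
  shows "positive_op sc ip (\<lambda>x. sc (of_real (d\<^sup>2)) x - B (B x))"
  unfolding positive_op_def
proof (intro conjI allI)
  note Bs = positive_opD(1)[OF B]
  show "selfadj sc ip (\<lambda>x. sc (of_real (d\<^sup>2)) x - B (B x))"
    by (intro selfadj_diff selfadj_sc selfadj_id selfadj_comp[OF Bs Bs refl])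
  fix x
  have "(nrm (B x))\<^sup>2 \<le> (d * nrm x)\<^sup>2"
    by (rule power_mono[OF positive_bound[OF B d]]) simp
  then show "0 \<le> Re (ip (sc (of_real (d\<^sup>2)) x - B (B x)) x)"
    using selfadj_ip[OF Bs, of "B x" x]
    by (simp add: ip_simps nrm_sq power_mult_distrib del: of_real_power)
qed

lemma positive_squares_diff:
  assumes B: "positive_op sc ip B" and e: "\<And>x. e * (nrm x)\<^sup>2 \<le> Re (ip (B x) x)" "0 \<le> e"
  shows "positive_op sc ip (\<lambda>x. B (B x) - sc (of_real (e\<^sup>2)) x)"
  unfolding positive_op_def
proof (intro conjI allI)
  note Bs = positive_opD(1)[OF B]
  show "selfadj sc ip (\<lambda>x. B (B x) - sc (of_real (e\<^sup>2)) x)"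
    by (intro selfadj_diff selfadj_sc selfadj_id selfadj_comp[OF Bs Bs refl])
  fix x
  have "e * nrm x \<le> nrm (B x)"
  proof (cases "x = 0")
    case False
    then have pos: "nrm x > 0" using nrm_ge_0[of x] nrm_eq_0[of x] by linarith
    have "(e * nrm x) * nrm x \<le> nrm (B x) * nrm x"
      using e(1)[of x] cauchy_schwarz_Re[of "B x" x] by (simp add: power2_eq_square mult_ac)
    then show ?thesis using pos by simp
  qed simp
  then have "(e * nrm x)\<^sup>2 \<le> (nrm (B x))\<^sup>2"
    by (rule power_mono) (simp add: e(2))
  then show "0 \<le> Re (ip (B (B x) - sc (of_real (e\<^sup>2)) x) x)"
    using selfadj_ip[OF Bs, of "B x" x]
    by (simp add: ip_simps nrm_sq power_mult_distrib del: of_real_power)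
qed

text \<open>Factor \<open>B^2 - t^2 = (B + t)(B - t)\<close>: the first factor is injective because
  \<open>B\<close> is positive and \<open>t > 0\<close>, the second by assumption.\<close>

lemma squares_diff_inj:
  assumes B: "positive_op sc ip B" and t: "t > 0"
    and inj: "\<And>y. B y = sc (of_real t) y \<Longrightarrow> y = 0"
    and x: "B (B x) = sc (of_real (t\<^sup>2)) x"
  shows "x = 0"
proof -
  note lin = clin_simps[OF selfadj_clin[OF positive_opD(1)[OF B]]]
  define u where "u = B x - sc (of_real t) x"
  have sum0: "B u + sc (of_real t) u = 0"
    by (simp add: u_def lin x vs.scale_right_diff_distrib power2_eq_square)
  have "Re (ip (B u) u) + t * (nrm u)\<^sup>2 = 0"
    using arg_cong[OF sum0, of "\<lambda>v. Re (ip v u)"] by (simp add: ip_simps nrm_sq)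
  moreover have "0 \<le> t * (nrm u)\<^sup>2" using t by simp
  ultimately have "t * (nrm u)\<^sup>2 = 0" using positive_opD(2)[OF B, of u] by linarith
  then have "u = 0" using t by simp
  then show ?thesis using inj[of x] by (simp add: u_def)
qed

lemma inverse_exists:
  assumes B: "positive_op sc ip B" and e0: "e > 0" and e: "\<And>x. e * (nrm x)\<^sup>2 \<le> Re (ip (B x) x)"
  shows "\<exists>G. selfadj sc ip G \<and> (\<forall>x. B (G x) = x) \<and> (\<forall>x. G (B x) = x)
    \<and> commutant sc ip {B} \<subseteq> commutant sc ip {G}"
proof -
  note Bs = positive_opD(1)[OF B]
  note lin = clin_simps[OF selfadj_clin[OF Bs]]
  \<comment> \<open>With \<open>k'\<close> below, this makes the norm of the form
    \<open>ip (B x) y\<close> equivalent to \<open>nrm\<close>, so that completeness carries over to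
    the form.\<close>
  have e': "nrm x \<le> sqrt (Re (ip (B x) x)) / sqrt e" for x
    using real_sqrt_le_mono[OF e[of x]] e0 by (simp add: real_sqrt_mult field_simps)
  obtain k where k: "\<And>x. nrm (B x) \<le> k * nrm x" "k > 0"
    using bdd_opE[OF selfadj_bdd[OF Bs]] by metis
  have k': "sqrt (Re (ip (B x) x)) \<le> sqrt k * nrm x" for x
  proof -
    have "Re (ip (B x) x) \<le> k * (nrm x)\<^sup>2"
      using cauchy_schwarz_Re[of "B x" x] mult_right_mono[OF k(1)[of x], of "nrm x"]
      by (simp add: power2_eq_square)
    then show ?thesis using real_sqrt_le_mono by (fastforce simp: real_sqrt_mult)
  qed
  \<comment> \<open>The Riesz vector of \<open>x \<mapsto> \<langle>x, y\<rangle>\<close> for the inner product \<open>\<langle>Bx, y\<rangle>\<close> is the preimage of \<open>y\<close> under \<open>B\<close>.\<close>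
  interpret form: hspace sc "\<lambda>x y. ip (B x) y"
  proof
    fix x y show "ip (B y) x = cnj (ip (B x) y)"
      using selfadj_ip[OF Bs] by (metis ip_commute)
  next
    fix x assume "ip (B x) x = 0"
    then have "e * (nrm x)\<^sup>2 \<le> 0" using e[of x] by simp
    then show "x = 0" using e0 by (simp add: mult_le_0_iff)
  next
    fix X :: "nat \<Rightarrow> 'a"
    assume C: "\<forall>r>0. \<exists>N. \<forall>m\<ge>N. \<forall>n\<ge>N. sqrt (Re (ip (B (X m - X n)) (X m - X n))) < r"
    have "\<exists>L. cvg X L"
    proof (rule complete_cvg)
      fix r :: real assume "r > 0"
      then obtain N where N: "\<forall>m\<ge>N. \<forall>n\<ge>N. sqrt (Re (ip (B (X m - X n)) (X m - X n))) < r * sqrt e"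
        using C e0 by (meson mult_pos_pos real_sqrt_gt_zero)
      have "nrm (X m - X n) < r" if "m \<ge> N" "n \<ge> N" for m n
      proof -
        have "sqrt (Re (ip (B (X m - X n)) (X m - X n))) / sqrt e < r"
          using N that e0 by (simp add: pos_divide_less_eq)
        then show ?thesis using e'[of "X m - X n"] by linarith
      qed
      then show "\<exists>N. \<forall>m\<ge>N. \<forall>n\<ge>N. nrm (X m - X n) < r" by blast
    qed
    then obtain L where L: "cvg X L" by blast
    have "(\<lambda>n. sqrt k * nrm (X n - L)) \<longlonglongrightarrow> 0"
      using tendsto_mult_left[OF L[unfolded cvg_def], of "sqrt k"] by simp
    then have lim: "\<forall>r>0. \<exists>N. \<forall>n\<ge>N. sqrt k * nrm (X n - L) < r"
      unfolding LIMSEQ_def by (simp add: k(2) abs_mult less_imp_le)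
    have "\<forall>r>0. \<exists>N. \<forall>n\<ge>N. sqrt (Re (ip (B (X n - L)) (X n - L))) < r"
      using lim k' le_less_trans by meson
    then show "\<exists>L. \<forall>r>0. \<exists>N. \<forall>n\<ge>N. sqrt (Re (ip (B (X n - L)) (X n - L))) < r" by blast
  qed (simp_all add: lin ip_simps vs.scale_right_distrib vs.scale_left_distrib positive_opD(2)[OF B])
  have "\<exists>z. \<forall>x. ip x y = ip (B x) z" for y
  proof (rule form.riesz)
    fix x
    have "cmod (ip x y) \<le> 2 * (nrm x * nrm y)" by (rule cmod_ip_le)
    also have "\<dots> \<le> 2 * (form.nrm x / sqrt e * nrm y)"
      using e'[of x] by (intro mult_left_mono mult_right_mono) (simp_all add: form.nrm_def)
    finally show "cmod (ip x y) \<le> (2 * nrm y / sqrt e) * form.nrm x" by (simp add: mult_ac)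
  qed (simp_all add: ip_simps)
  then obtain G where G: "\<And>x y. ip x y = ip (B x) (G y)" by metis
  have BG: "B (G y) = y" for y
    by (rule ip_ext) (simp flip: G selfadj_ip[OF Bs])
  have B0: "B x = 0 \<Longrightarrow> x = 0" for x
    using e'[of x] nrm_ge_0[of x] nrm_eq_0[of x] by simp
  have inj: "B x = B y \<Longrightarrow> x = y" for x y
    using B0[of "x - y"] by (simp add: lin)
  have GB: "G (B x) = x" for x by (rule inj) (simp add: BG)
  have "clin sc G"
    unfolding clin_def by (intro conjI allI; rule inj; simp add: BG lin)
  moreover have "nrm (G y) \<le> (1 / e) * nrm y" for y
  proof (cases "G y = 0")
    case False
    then have pos: "nrm (G y) > 0" using nrm_ge_0[of "G y"] nrm_eq_0[of "G y"] by linarith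
    have "e * (nrm (G y))\<^sup>2 \<le> nrm y * nrm (G y)"
      using e[of "G y"] cauchy_schwarz_Re[of y "G y"] by (simp add: BG)
    then have "e * nrm (G y) \<le> nrm y" using pos by (simp add: power2_eq_square)
    then show ?thesis using e0 by (simp add: field_simps)
  qed (use e0 in simp)
  ultimately have Gb: "bdd_op sc ip G" by (rule bdd_opI)
  have "is_adjoint ip G G"
    unfolding is_adjoint_def using G BG by metis
  moreover have "commutant sc ip {B} \<subseteq> commutant sc ip {G}"
  proof
    fix X assume X: "X \<in> commutant sc ip {B}"
    then have XB: "X (B x) = B (X x)" for x by (rule commutant_eq) simp
    have "X (G x) = G (X x)" for x
      by (rule inj) (simp add: BG flip: XB)
    then show "X \<in> commutant sc ip {G}"
      by (intro commutantI commutant_bdd[OF X]) auto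
  qed
  ultimately show ?thesis using selfadjI[OF Gb] BG GB by blast
qed

text \<open>The commutant of a set closed under adjoints is spanned by its unitaries: its elements
  are combinations of self-adjoint ones, and a self-adjoint one is a multiple of a contraction,
  which is the mean of a unitary and its adjoint.\<close>

lemma commutant_unitaries:
  assumes F: "\<And>X. X \<in> F \<Longrightarrow> \<exists>X'\<in>F. is_adjoint ip X X'" "\<And>X. X \<in> F \<Longrightarrow> bdd_op sc ip X"
    and Y: "bdd_op sc ip Y"
    and comm: "\<And>W W' x. W \<in> commutant sc ip F \<Longrightarrow> W' \<in> commutant sc ip F \<Longrightarrow> is_adjoint ip W W'
      \<Longrightarrow> (\<And>x. W (W' x) = x) \<Longrightarrow> (\<And>x. W' (W x) = x) \<Longrightarrow> Y (W x) = W (Y x)"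
  shows "Y \<in> commutant sc ip (commutant sc ip F)"
proof (rule commutantI[OF Y])
  let ?M = "commutant sc ip F"
  have Flin: "\<And>X. X \<in> F \<Longrightarrow> clin sc X" using F(2) bdd_op_clin by blast
  note linY = clin_simps[OF bdd_op_clin[OF Y]]
  have sa: "Y (D x) = D (Y x)" if D: "D \<in> ?M" "is_adjoint ip D D" for D x
  proof -
    obtain k where k: "k > 0" "\<And>x. nrm (D x) \<le> k * nrm x"
      using bdd_opE[OF commutant_bdd[OF D(1)]] by metis
    define E where "E = (\<lambda>x. sc (of_real (1 / k)) (D x))"
    have EM: "E \<in> ?M" unfolding E_def by (intro commutant_sc D Flin)
    have Es: "selfadj sc ip E"
      unfolding E_def using selfadj_sc[OF selfadjI[OF commutant_bdd[OF D(1)] D(2)]] .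
    note linE = clin_simps[OF selfadj_clin[OF Es]]
    have E1: "nrm (E x) \<le> nrm x" for x
      using k by (simp add: E_def norm_divide field_simps)
    define A where "A = (\<lambda>x. x - E (E x))"
    have "positive_op sc ip A"
      unfolding positive_op_def
    proof (intro conjI allI)
      show "selfadj sc ip A" unfolding A_def by (intro selfadj_diff selfadj_id selfadj_comp[OF Es Es refl])
      fix x
      have "(nrm (E x))\<^sup>2 \<le> (nrm x)\<^sup>2" by (rule power_mono[OF E1]) simp
      then show "0 \<le> Re (ip (A x) x)"
        by (simp add: A_def ip_simps nrm_sq selfadj_ip[OF Es, of "E _"])
    qed
    then obtain R where R: "positive_op sc ip R" "\<And>x. R (R x) = A x"
      "commutant sc ip {A} \<subseteq> commutant sc ip {R}"
      using sqrt_exists by blast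
    note Rs = positive_opD(1)[OF R(1)]
    note linR = clin_simps[OF selfadj_clin[OF Rs]]
    have AM: "A \<in> ?M" unfolding A_def by (intro commutant_diff commutant_id commutant_comp[OF _ EM EM] Flin)
    have Rcomm: "X (R x) = R (X x)" if "bdd_op sc ip X" "\<And>x. X (A x) = A (X x)" for X x
    proof -
      have "X \<in> commutant sc ip {A}" by (rule commutantI) (auto simp: that)
      then have "X \<in> commutant sc ip {R}" using R(3) by blast
      then show ?thesis by (rule commutant_eq) simp
    qed
    \<comment> \<open>Each \<open>X\<close> in \<open>F\<close> commutes with \<open>A\<close>,
      hence with its root; so the unitaries built from \<open>R\<close> stay in the
      commutant.\<close>
    have RM: "R \<in> ?M"
    proof (rule commutantI[OF selfadj_bdd[OF Rs]])
      fix X x assume X: "X \<in> F"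
      show "R (X x) = X (R x)"
        using Rcomm[OF F(2)[OF X] commutant_eq[OF AM X, symmetric]] by simp
    qed
    have ER: "E (R x) = R (E x)" for x
      by (rule Rcomm[OF selfadj_bdd[OF Es]]) (simp add: A_def linE)
    \<comment> \<open>A self-adjoint contraction \<open>E\<close> is the real part of the unitary \<open>E + i \<surd>(1 - E\<^sup>2)\<close>.\<close>
    define W where "W = (\<lambda>x. E x + sc \<i> (R x))"
    define W' where "W' = (\<lambda>x. E x + sc (- \<i>) (R x))"
    have WM: "W \<in> ?M" "W' \<in> ?M"
      unfolding W_def W'_def by (intro commutant_add commutant_sc EM RM Flin; simp)+
    have adj: "is_adjoint ip W W'"
      unfolding W_def W'_def
      using is_adjoint_add[OF selfadj_adj[OF Es] is_adjoint_sc[OF selfadj_adj[OF Rs], of \<i>]] by simp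
    have un: "W (W' x) = x" "W' (W x) = x" for x
      by (rule ip_ext; simp add: W_def W'_def linE linR ip_simps ER R(2) A_def algebra_simps)+
    have "Y (W x) = W (Y x)" by (rule comm[OF WM adj un])
    moreover have "Y (W' x) = W' (Y x)" by (rule comm[OF WM(2,1) is_adjoint_sym[OF adj] un(2,1)])
    ultimately have "Y (W x) + Y (W' x) = W (Y x) + W' (Y x)" by simp
    then have "Y (E x) + Y (E x) = E (Y x) + E (Y x)"
      by (simp add: W_def W'_def linY algebra_simps)
    then have "sc 2 (Y (E x)) = sc 2 (E (Y x))"
      using sc_add_left[of 1 1] by simp
    then have "sc (of_real k) (Y (E x)) = sc (of_real k) (E (Y x))" by simp
    then show ?thesis using k(1) by (simp add: E_def linY)
  qed
  fix X x assume X: "X \<in> ?M"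
  obtain X' where X': "X' \<in> ?M" "is_adjoint ip X X'"
    using commutant_adjoint_ex[OF F(1) X] by blast
  \<comment> \<open>Self-adjoint parts of \<open>X\<close> up to scaling; they recombine as
    \<open>i D1 + D2 = 2 i X\<close>.\<close>
  define D1 where "D1 = (\<lambda>x. X x + X' x)"
  define D2 where "D2 = (\<lambda>x. sc \<i> (X x) - sc \<i> (X' x))"
  have "Y (D1 x) = D1 (Y x)"
  proof (rule sa)
    show "D1 \<in> ?M" unfolding D1_def by (intro commutant_add X X' Flin)
    show "is_adjoint ip D1 D1"
      unfolding D1_def using is_adjoint_add[OF X'(2) is_adjoint_sym[OF X'(2)]] by (simp add: add.commute)
  qed
  moreover have "Y (D2 x) = D2 (Y x)"
  proof (rule sa)
    show "D2 \<in> ?M" unfolding D2_def by (intro commutant_diff commutant_sc X X' Flin)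
    show "is_adjoint ip D2 D2"
      unfolding D2_def
      using is_adjoint_diff[OF is_adjoint_sc[OF X'(2), of \<i>] is_adjoint_sc[OF is_adjoint_sym[OF X'(2)], of \<i>]]
      by (simp add: add.commute)
  qed
  ultimately have "sc \<i> (Y (D1 x)) + Y (D2 x) = sc \<i> (D1 (Y x)) + D2 (Y x)" by simp
  then have "sc \<i> (Y (X x)) + sc \<i> (Y (X x)) = sc \<i> (X (Y x)) + sc \<i> (X (Y x))"
    by (simp add: D1_def D2_def linY vs.scale_right_distrib)
  then have "sc (2 * \<i>) (Y (X x)) = sc (2 * \<i>) (X (Y x))"
    using sc_add_left[of \<i> \<i>] by simp
  then show "Y (X x) = X (Y x)" by simp
qed


text \<open>\<open>B\<close> commutes with itself, so its bicommutant is contained in its commutant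
  and is therefore abelian.\<close>

lemma bicommutant_commute:
  assumes "bdd_op sc ip B"
    and "S \<in> commutant sc ip (commutant sc ip {B})" "T \<in> commutant sc ip (commutant sc ip {B})"
  shows "S (T x) = T (S x)"
proof -
  have "B \<in> commutant sc ip {B}" by (rule commutantI) (simp_all add: assms(1))
  then have "T (B y) = B (T y)" for y by (rule commutant_eq[OF assms(3)])
  then have "T \<in> commutant sc ip {B}" by (intro commutantI commutant_bdd[OF assms(3)]) simp
  then show ?thesis by (rule commutant_eq[OF assms(2)])
qed

text \<open>Places square roots and inverses in a bicommutant; their existence lemmas supply the
  inclusion \<open>sub\<close>.\<close>

lemma bicommutant_trans:
  assumes A: "A \<in> commutant sc ip (commutant sc ip F)" and R: "bdd_op sc ip R"
    and sub: "commutant sc ip {A} \<subseteq> commutant sc ip {R}"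
  shows "R \<in> commutant sc ip (commutant sc ip F)"
proof (rule commutantI[OF R])
  fix X x assume X: "X \<in> commutant sc ip F"
  have "X \<in> commutant sc ip {A}"
    by (rule commutantI[OF commutant_bdd[OF X]]) (use commutant_eq[OF A X] in auto)
  then have "X \<in> commutant sc ip {R}" using sub by blast
  then have "X (R x) = R (X x)" by (rule commutant_eq) simp
  then show "R (X x) = X (R x)" by simp
qed

text \<open>Splits the strict bound into a form estimate and the exclusion of \<open>r\<close> as an
  eigenvalue; the latter is what makes the sine injective below.\<close>

lemma op_less_scalar_left:
  assumes "op_less sc ip (\<lambda>x. sc (of_real r) x) B"
  shows "r * (nrm x)\<^sup>2 \<le> Re (ip (B x) x)" and "B x = sc (of_real r) x \<Longrightarrow> x = 0"
proof -
  have "0 \<le> Re (ip (B x - sc (of_real r) x) x)"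
    using assms unfolding op_less_def positive_op_def by blast
  then show "r * (nrm x)\<^sup>2 \<le> Re (ip (B x) x)" by (simp add: ip_simps nrm_sq)
  have pos: "positive_op sc ip (\<lambda>x. B x - sc (of_real r) x)" and inj: "inj (\<lambda>x. B x - sc (of_real r) x)"
    using assms unfolding op_less_def by blast+
  assume "B x = sc (of_real r) x"
  then have "B x - sc (of_real r) x = B 0 - sc (of_real r) 0"
    using clin_0[OF selfadj_clin[OF positive_opD(1)[OF pos]]] by simp
  then show "x = 0" using injD[OF inj] by blast
qed

lemma op_less_scalar_right:
  assumes "op_less sc ip B (\<lambda>x. sc (of_real r) x)"
  shows "Re (ip (B x) x) \<le> r * (nrm x)\<^sup>2" and "B x = sc (of_real r) x \<Longrightarrow> x = 0"
proof -
  have "0 \<le> Re (ip (sc (of_real r) x - B x) x)"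
    using assms unfolding op_less_def positive_op_def by blast
  then show "Re (ip (B x) x) \<le> r * (nrm x)\<^sup>2" by (simp add: ip_simps nrm_sq)
  have pos: "positive_op sc ip (\<lambda>x. sc (of_real r) x - B x)" and inj: "inj (\<lambda>x. sc (of_real r) x - B x)"
    using assms unfolding op_less_def by blast+
  assume "B x = sc (of_real r) x"
  then have "sc (of_real r) x - B x = sc (of_real r) 0 - B 0"
    using clin_0[OF selfadj_clin[OF positive_opD(1)[OF pos]]] by simp
  then show "x = 0" using injD[OF inj] by blast
qed

text \<open>
  \<open>c\<close> and \<open>s\<close> are the cosine and sine of the angle of the reflection \<open>U\<close>. Since
  \<open>16\<lambda>\<^sup>2B\<^sup>2(1 - c\<^sup>2) = ((1+\<bar>\<lambda>\<bar>)\<^sup>2 - 4B\<^sup>2)(4B\<^sup>2 - (1-\<bar>\<lambda>\<bar>)\<^sup>2)\<close>, the sine is a product of roots of the two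
  factors and of \<open>B\<^sup>-\<^sup>1\<close>. The inverse may be unbounded when \<open>\<bar>\<lambda>\<bar> = 1\<close>, but then it cancels.
\<close>

lemma angle_operators:
  fixes lam :: real
  assumes lam: "lam \<noteq> 0" and B: "positive_op sc ip B"
    and lower: "op_less sc ip (\<lambda>x. sc (of_real (\<bar>1 - \<bar>lam\<bar>\<bar> / 2)) x) B"
    and upper: "op_less sc ip B (\<lambda>x. sc (of_real ((1 + \<bar>lam\<bar>) / 2)) x)"
  shows "\<exists>c s. selfadj sc ip c \<and> selfadj sc ip s
    \<and> c \<in> commutant sc ip (commutant sc ip {B}) \<and> s \<in> commutant sc ip (commutant sc ip {B})
    \<and> (\<forall>x. s x = 0 \<longrightarrow> x = 0) \<and> (\<forall>x. c (c x) + s (s x) = x)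
    \<and> (\<forall>x. sc (of_real (4 * lam)) (c (B x)) = sc 4 (B (B x)) + sc (of_real (lam\<^sup>2 - 1)) x)"
proof -
  let ?M = "commutant sc ip (commutant sc ip {B})"
  note Bs = positive_opD(1)[OF B]
  note Bb = selfadj_bdd[OF Bs]
  note linB = clin_simps[OF selfadj_clin[OF Bs]]
  have Mlin: "\<And>X. X \<in> commutant sc ip {B} \<Longrightarrow> clin sc X"
    using commutant_bdd bdd_op_clin by blast
  note Mid = commutant_id[OF Mlin] and Msc = commutant_sc[OF Mlin] and Madd = commutant_add[OF Mlin]
    and Mdiff = commutant_diff[OF Mlin] and Mcomp = commutant_comp[OF Mlin]
  note Mcomm = bicommutant_commute[OF Bb]
  have BM: "B \<in> ?M" using subset_bicommutant[of "{B}"] Bb by blast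
  define d where "d = (1 + \<bar>lam\<bar>) / 2"
  define e where "e = \<bar>1 - \<bar>lam\<bar>\<bar> / 2"
  have d0: "d > 0" by (simp add: d_def)
  note up = op_less_scalar_right[OF upper, folded d_def]
  note low = op_less_scalar_left[OF lower, folded e_def]
  define F1 where "F1 = (\<lambda>x. sc (of_real (d\<^sup>2)) x - B (B x))"
  have F1: "positive_op sc ip F1" unfolding F1_def by (rule positive_diff_squares[OF B up(1)])
  then obtain R1 where R1: "positive_op sc ip R1" "\<And>x. R1 (R1 x) = F1 x"
    "commutant sc ip {F1} \<subseteq> commutant sc ip {R1}"
    using sqrt_exists by blast
  note R1s = positive_opD(1)[OF R1(1)]
  have "F1 \<in> ?M" unfolding F1_def by (intro Mdiff Msc Mid Mcomp[OF _ BM BM])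
  then have R1M: "R1 \<in> ?M" by (rule bicommutant_trans[OF _ selfadj_bdd[OF R1s] R1(3)])
  have R1inj: "x = 0" if "R1 x = 0" for x
  proof -
    have "F1 x = 0" using that clin_0[OF selfadj_clin[OF R1s]] R1(2)[of x] by simp
    then show ?thesis using squares_diff_inj[OF B d0 up(2), of x] by (simp add: F1_def)
  qed
  show ?thesis
  proof (cases "e = 0")
    case True
    then have lam1: "lam * lam = 1" and d1: "d = 1"
      by (auto simp: e_def d_def abs_if split: if_splits)
    \<comment> \<open>Here \<open>\<bar>lam\<bar> = 1\<close>, so the equation for \<open>c\<close>
      reads \<open>lam c B = B^2\<close>, solved by \<open>c = B / lam\<close>. Then
      \<open>1 - c^2 = 1 - B^2 = F1\<close>, and its root \<open>R1\<close> serves as the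
      sine.\<close>
    define c where "c = (\<lambda>x. sc (of_real (1 / lam)) (B x))"
    show ?thesis
    proof (intro exI conjI allI impI)
      show "selfadj sc ip c" unfolding c_def by (rule selfadj_sc[OF Bs])
      show "c \<in> ?M" unfolding c_def by (intro Msc BM)
      show "c (c x) + R1 (R1 x) = x" for x
        using lam1 by (simp add: c_def R1(2) F1_def d1 linB flip: of_real_mult)
      show "sc (of_real (4 * lam)) (c (B x)) = sc 4 (B (B x)) + sc (of_real (lam\<^sup>2 - 1)) x" for x
        using lam lam1 by (simp add: c_def power2_eq_square)
    qed (fact R1s R1M R1inj)+
  next
    case False
    then have e0: "e > 0" by (simp add: e_def)
    obtain G where G: "selfadj sc ip G" "\<And>x. B (G x) = x" "\<And>x. G (B x) = x"
      "commutant sc ip {B} \<subseteq> commutant sc ip {G}"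
      using inverse_exists[OF B e0 low(1)] by blast
    have GM: "G \<in> ?M" by (rule bicommutant_trans[OF BM selfadj_bdd[OF G(1)] G(4)])
    define F2 where "F2 = (\<lambda>x. B (B x) - sc (of_real (e\<^sup>2)) x)"
    have F2: "positive_op sc ip F2"
      unfolding F2_def using positive_squares_diff[OF B low(1)] e0 by simp
    then obtain R2 where R2: "positive_op sc ip R2" "\<And>x. R2 (R2 x) = F2 x"
      "commutant sc ip {F2} \<subseteq> commutant sc ip {R2}"
      using sqrt_exists by blast
    note R2s = positive_opD(1)[OF R2(1)]
    have "F2 \<in> ?M" unfolding F2_def by (intro Mdiff Msc Mid Mcomp[OF _ BM BM])
    then have R2M: "R2 \<in> ?M" by (rule bicommutant_trans[OF _ selfadj_bdd[OF R2s] R2(3)])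
    have R2inj: "x = 0" if "R2 x = 0" for x
    proof -
      have "F2 x = 0" using that clin_0[OF selfadj_clin[OF R2s]] R2(2)[of x] by simp
      then show ?thesis using squares_diff_inj[OF B e0 low(2), of x] by (simp add: F2_def)
    qed
    note linG = clin_simps[OF selfadj_clin[OF G(1)]]
    note lin1 = clin_simps[OF selfadj_clin[OF R1s]]
    note lin2 = clin_simps[OF selfadj_clin[OF R2s]]
    define p where "p = (\<lambda>x. R1 (R2 x))"
    have ps: "selfadj sc ip p" unfolding p_def by (rule selfadj_comp[OF R1s R2s Mcomm[OF R1M R2M]])
    have pM: "p \<in> ?M" unfolding p_def by (rule Mcomp[OF _ R1M R2M])
    have pp: "p (p x) = F1 (F2 x)" for x
      by (simp add: p_def Mcomm[OF R2M R1M] R1(2) R2(2))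
    define q where "q = (\<lambda>x. p (G x))"
    have qs: "selfadj sc ip q" unfolding q_def by (rule selfadj_comp[OF ps G(1) Mcomm[OF pM GM]])
    have qM: "q \<in> ?M" unfolding q_def by (rule Mcomp[OF _ pM GM])
    \<comment> \<open>So \<open>s^2 = (d^2 - B^2)(B^2 - e^2) / (lam^2 B^2)\<close>, while
      \<open>c\<close> below is the required equation divided by \<open>4 lam B\<close>.\<close>
    define s where "s = (\<lambda>x. sc (of_real (1 / lam)) (q x))"
    define f where "f = (\<lambda>x. sc (of_real 4) (B x) + sc (of_real (lam\<^sup>2 - 1)) (G x))"
    have fs: "selfadj sc ip f"
      using selfadj_add[OF selfadj_sc[OF Bs, of 4] selfadj_sc[OF G(1), of "lam\<^sup>2 - 1"]]
      by (simp add: f_def)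
    define c where "c = (\<lambda>x. sc (of_real (1 / (4 * lam))) (f x))"
    show ?thesis
    proof (intro exI conjI allI impI)
      show "selfadj sc ip c" unfolding c_def by (rule selfadj_sc[OF fs])
      show "selfadj sc ip s" unfolding s_def by (intro selfadj_sc qs)
      show "c \<in> ?M" unfolding c_def f_def by (intro Msc Madd BM GM)
      show "s \<in> ?M" unfolding s_def by (intro Msc qM)
      show "x = 0" if "s x = 0" for x
      proof -
        have "p (G x) = 0" using that lam by (simp add: s_def q_def)
        then have "G x = 0" using R1inj[of "R2 (G x)"] R2inj[of "G x"] by (simp add: p_def)
        then have "B (G x) = 0" by (simp add: linB)
        then show ?thesis by (simp add: G(2))
      qed
      show "sc (of_real (4 * lam)) (c (B x)) = sc 4 (B (B x)) + sc (of_real (lam\<^sup>2 - 1)) x" for x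
        using lam by (simp add: c_def f_def G(3))
      show "c (c x) + s (s x) = x" for x
      proof -
        \<comment> \<open>Writing \<open>x = B^2 w\<close> cancels every inverse, and
          \<open>c^2 + s^2 = 1\<close> becomes a polynomial identity in \<open>B\<close> applied to
          \<open>w\<close>.\<close>
        define w where "w = G (G x)"
        have x: "x = B (B w)" by (simp add: w_def G(2))
        define r :: real where "r = lam\<^sup>2"
        have r: "r \<noteq> 0" "lam * lam = r" using lam by (simp_all add: r_def power2_eq_square)
        have "q (q x) = F1 (F2 w)"
          unfolding x q_def using Mcomm[OF pM GM] pp by (metis G(3))
        then have ss: "s (s x) = sc (of_real (1 / r)) (F1 (F2 w))"
          by (simp add: s_def clin_simps[OF selfadj_clin[OF qs]] flip: r(2))
        have fx: "f x = sc 4 (B (B (B w))) + sc (of_real (r - 1)) (B w)"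
          by (simp add: f_def x G(3) r_def)
        have ff: "f (f x) = sc 16 (B (B (B (B w)))) + sc (of_real (8 * (r - 1))) (B (B w))
            + sc (of_real ((r - 1)\<^sup>2)) w"
          unfolding fun_cong[OF f_def, of "f x"] r_def[symmetric]
          by (intro ip_ext) (simp add: fx linB linG G(3) ip_simps power2_eq_square, simp add: algebra_simps)
        have "c (c x) = sc (of_real (1 / (16 * r))) (f (f x))"
          by (simp add: c_def clin_sc[OF selfadj_clin[OF fs]] mult_ac flip: r(2))
        \<comment> \<open>These are the coefficients in the expansion of
          \<open>(d^2 - B^2)(B^2 - e^2)\<close>; rewriting them in \<open>r = lam^2\<close> removes
          the absolute values.\<close>
        have de: "d\<^sup>2 * e\<^sup>2 = (r - 1)\<^sup>2 / 16" "d\<^sup>2 + e\<^sup>2 = (1 + r) / 2"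
        proof -
          have "d\<^sup>2 * e\<^sup>2 = ((1 + \<bar>lam\<bar>) * (1 - \<bar>lam\<bar>))\<^sup>2 / 16"
            by (simp add: d_def e_def power_mult_distrib power_divide)
          also have "(1 + \<bar>lam\<bar>) * (1 - \<bar>lam\<bar>) = 1 - r"
            by (simp add: r_def power2_eq_square algebra_simps)
          finally show "d\<^sup>2 * e\<^sup>2 = (r - 1)\<^sup>2 / 16" by (simp add: power2_commute)
          show "d\<^sup>2 + e\<^sup>2 = (1 + r) / 2"
            by (simp add: d_def e_def r_def power_divide power2_sum power2_diff field_simps)
        qed
        have "F1 (F2 w) = sc (of_real ((1 + r) / 2)) (B (B w)) - sc (of_real ((r - 1)\<^sup>2 / 16)) w
            - B (B (B (B w)))"
          unfolding de[symmetric] by (intro ip_ext) (simp add: F1_def F2_def linB ip_simps algebra_simps)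
        have "c (c x) + s (s x) = B (B w)"
          unfolding ss \<open>F1 (F2 w) = _\<close> \<open>c (c x) = _\<close> ff
          using r(1) by (intro ip_ext) (simp add: ip_simps field_simps)
        then show ?thesis by (simp add: x)
      qed
    qed
  qed
qed


section \<open>Pairs of projections\<close>

text \<open>Solutions are built as self-adjoint involutions \<open>U\<close> and \<open>V\<close>,
  and this passes from \<open>U = 2P - 1\<close> back to the projection.\<close>

lemma is_proj_reflection:
  assumes U: "selfadj sc ip U" "\<And>x. U (U x) = x"
  shows "is_proj sc ip (\<lambda>x. sc (1/2) (x + U x))"
proof -
  have "selfadj sc ip (\<lambda>x. sc (1/2) (x + U x))"
    using selfadj_sc[OF selfadj_add[OF selfadj_id U(1)], of "1/2"] by simp
  moreover have "sc (1/2) (sc (1/2) (x + U x) + U (sc (1/2) (x + U x))) = sc (1/2) (x + U x)" for x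
    by (rule ip_ext) (simp add: clin_simps[OF selfadj_clin[OF U(1)]] U(2) ip_simps field_simps)
  ultimately show ?thesis unfolding is_proj_def by (auto simp: fun_eq_iff)
qed

text \<open>Up to a scalar, \<open>D^2\<close> is \<open>lam\<close> times
  \<open>PQ + QP - P - Q\<close>. Multiplied by \<open>P\<close> from either side, this gives
  \<open>PQP - P\<close>; multiplied by \<open>Q\<close>, it gives \<open>QPQ - Q\<close>.\<close>

lemma proj_pair_commute:
  fixes lam :: real
  assumes P: "is_proj sc ip P" and Q: "is_proj sc ip Q"
    and D: "\<And>x. D x = sc (of_real lam) (P x) + Q x - sc (of_real ((1 + lam) / 2)) x"
  shows "P (D (D x)) = D (D (P x))" "Q (D (D x)) = D (D (Q x))"
proof -
  have lin: "clin sc P" "clin sc Q" using P Q selfadj_clin by (auto simp: is_proj_def)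
  have "P (P x) = P x" "Q (Q x) = Q x" for x
    using P Q by (auto simp: is_proj_def fun_eq_iff)
  note rules = this clin_simps[OF lin(1)] clin_simps[OF lin(2)] ip_simps
  show "P (D (D x)) = D (D (P x))"
    by (rule ip_ext, simp add: D rules, simp add: field_simps)
  show "Q (D (D x)) = D (D (Q x))"
    by (rule ip_ext, simp add: D rules, simp add: field_simps)
qed

end

section \<open>Operator matrices\<close>

interpretation K: hspace "scaleC :: complex \<Rightarrow> 'k::chilbert \<Rightarrow> 'k" cinner
  by unfold_locales
    (fact scaleC_add_right scaleC_add_left scaleC_scaleC scaleC_one cinner_add_left
      cinner_scaleC_left cinner_commute cinner_nonneg cinner_eq_zero complete)+

interpretation H: hspace "scH :: complex \<Rightarrow> 'k::chilbert \<times> 'k \<Rightarrow> 'k \<times> 'k" ipH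
proof
  fix X :: "nat \<Rightarrow> 'k \<times> 'k"
  assume C: "\<forall>e>0. \<exists>N. \<forall>m\<ge>N. \<forall>n\<ge>N. sqrt (Re (ipH (X m - X n) (X m - X n))) < e"
  have le: "K.nrm (fst h) \<le> sqrt (Re (ipH h h))" "K.nrm (snd h) \<le> sqrt (Re (ipH h h))" for h :: "'k \<times> 'k"
    by (simp_all add: K.nrm_def ipH_def K.ip_nonneg)
  \<comment> \<open>Stated for a general \<open>g\<close> so that it serves both coordinates,
    \<open>fst\<close> and \<open>snd\<close>.\<close>
  have "\<exists>L. K.cvg (\<lambda>n. g (X n)) L"
    if g: "\<And>h h'. g (h - h') = g h - g h'" "\<And>h. K.nrm (g h) \<le> sqrt (Re (ipH h h))"
    for g :: "'k \<times> 'k \<Rightarrow> 'k"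
  proof (rule K.complete_cvg)
    fix e :: real assume "e > 0"
    then obtain N where N: "\<forall>m\<ge>N. \<forall>n\<ge>N. sqrt (Re (ipH (X m - X n) (X m - X n))) < e"
      using C by blast
    have "K.nrm (g (X m) - g (X n)) < e" if "m \<ge> N" "n \<ge> N" for m n
      using le_less_trans[OF g(2) N[rule_format, OF that]] by (simp only: g(1))
    then show "\<exists>N. \<forall>m\<ge>N. \<forall>n\<ge>N. K.nrm (g (X m) - g (X n)) < e" by blast
  qed
  from this[OF fst_diff le(1)] this[OF snd_diff le(2)]
  obtain L M where L: "K.cvg (\<lambda>n. fst (X n)) L" and M: "K.cvg (\<lambda>n. snd (X n)) M" by blast
  have lim: "(\<lambda>n. K.nrm (fst (X n) - L) + K.nrm (snd (X n) - M)) \<longlonglongrightarrow> 0"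
    using tendsto_add[OF L[unfolded K.cvg_def] M[unfolded K.cvg_def]] by simp
  have bound: "sqrt (Re (ipH (X n - (L, M)) (X n - (L, M)))) \<le> K.nrm (fst (X n) - L) + K.nrm (snd (X n) - M)" for n
    by (simp add: ipH_def K.nrm_def sqrt_add_le_add_sqrt K.ip_nonneg)
  have "(\<lambda>n. sqrt (Re (ipH (X n - (L, M)) (X n - (L, M))))) \<longlonglongrightarrow> 0"
    by (rule tendsto_sandwich[OF _ eventuallyI[OF bound] tendsto_const lim])
      (simp add: ipH_def K.ip_nonneg)
  then show "\<exists>L. \<forall>e>0. \<exists>N. \<forall>n\<ge>N. sqrt (Re (ipH (X n - L) (X n - L))) < e"
    unfolding LIMSEQ_def dist_real_def by (intro exI[of _ "(L, M)"]) (simp add: ipH_def K.ip_nonneg)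
next
  fix x y :: "'k \<times> 'k" show "ipH y x = cnj (ipH x y)"
    by (metis complex_cnj_add cinner_commute ipH_def)
next
  fix x :: "'k \<times> 'k" assume "ipH x x = 0"
  then have "Re (cinner (fst x) (fst x)) + Re (cinner (snd x) (snd x)) = 0"
    unfolding ipH_def by (metis plus_complex.sel(1) zero_complex.sel(1))
  then have "Re (cinner (fst x) (fst x)) = 0" "Re (cinner (snd x) (snd x)) = 0"
    using K.ip_nonneg[of "fst x"] K.ip_nonneg[of "snd x"] by linarith+
  then have "fst x = 0" "snd x = 0" by (simp_all add: K.ip_eq_zero complex_eq_iff)
  then show "x = 0" by (simp add: prod_eq_iff)
qed (auto simp: scH_def ipH_def K.sc_add_right K.sc_add_left K.ip_simps K.ip_nonneg algebra_simps prod_eq_iff)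

lemma bdd_op_matrix:
  fixes a b c d :: "'k::chilbert \<Rightarrow> 'k"
  assumes "bdd_op scaleC cinner a" "bdd_op scaleC cinner b" "bdd_op scaleC cinner c" "bdd_op scaleC cinner d"
  shows "bdd_op scH ipH (\<lambda>h. (a (fst h) + b (snd h), c (fst h) + d (snd h)))"
proof -
  note lin = assms[THEN K.bdd_op_clin, unfolded clin_def]
  have le: "K.nrm (fst h) \<le> H.nrm h" "K.nrm (snd h) \<le> H.nrm h" for h :: "'k \<times> 'k"
    by (simp_all add: K.nrm_def H.nrm_def ipH_def K.ip_nonneg)
  have bd: "\<exists>k. \<forall>h. K.nrm (a (fst h) + b (snd h)) \<le> k * H.nrm h"
    if ab: "bdd_op scaleC cinner a" "bdd_op scaleC cinner b" for a b :: "'k \<Rightarrow> 'k"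
  proof -
    obtain k where k: "k > 0" "\<And>x. K.nrm (a x) \<le> k * K.nrm x" using K.bdd_opE[OF ab(1)] by metis
    obtain l where l: "l > 0" "\<And>x. K.nrm (b x) \<le> l * K.nrm x" using K.bdd_opE[OF ab(2)] by metis
    have "K.nrm (a (fst h) + b (snd h)) \<le> (k + l) * H.nrm h" for h
    proof -
      have "K.nrm (a (fst h)) \<le> k * H.nrm h"
        using k(2)[of "fst h"] mult_left_mono[OF le(1)[of h], of k] k(1) by linarith
      moreover have "K.nrm (b (snd h)) \<le> l * H.nrm h"
        using l(2)[of "snd h"] mult_left_mono[OF le(2)[of h], of l] l(1) by linarith
      ultimately show ?thesis
        using K.nrm_triangle[of "a (fst h)" "b (snd h)"] by (simp add: distrib_right)
    qed
    then show ?thesis by blast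
  qed
  obtain k where k: "\<And>h. K.nrm (a (fst h) + b (snd h)) \<le> k * H.nrm h"
    using bd[OF assms(1,2)] by blast
  obtain l where l: "\<And>h. K.nrm (c (fst h) + d (snd h)) \<le> l * H.nrm h"
    using bd[OF assms(3,4)] by blast
  show ?thesis
  proof (rule H.bdd_opI)
    show "clin scH (\<lambda>h. (a (fst h) + b (snd h), c (fst h) + d (snd h)))"
      using lin by (simp add: clin_def scH_def K.sc_add_right algebra_simps)
    show "H.nrm (a (fst h) + b (snd h), c (fst h) + d (snd h)) \<le> (k + l) * H.nrm h" for h
    proof -
      have "H.nrm (a (fst h) + b (snd h), c (fst h) + d (snd h))
        \<le> K.nrm (a (fst h) + b (snd h)) + K.nrm (c (fst h) + d (snd h))"
        by (simp add: H.nrm_def ipH_def K.nrm_def sqrt_add_le_add_sqrt K.ip_nonneg)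
      then show ?thesis using k[of h] l[of h] by (simp add: distrib_right)
    qed
  qed
qed

text \<open>The entries are the coordinates of \<open>X (x, 0)\<close> and
  \<open>X (0, x)\<close>.\<close>

lemma matrix_of_bdd_op:
  fixes X :: "'k::chilbert \<times> 'k \<Rightarrow> 'k \<times> 'k"
  assumes X: "bdd_op scH ipH X"
  obtains a b c d where
    "bdd_op scaleC cinner a" "bdd_op scaleC cinner b" "bdd_op scaleC cinner c" "bdd_op scaleC cinner d"
    "X = (\<lambda>h. (a (fst h) + b (snd h), c (fst h) + d (snd h)))"
proof -
  note lin = H.clin_simps[OF H.bdd_op_clin[OF X]]
  obtain k where k: "\<And>h. H.nrm (X h) \<le> k * H.nrm h" using H.bdd_opE[OF X] by metis
  have le: "K.nrm (fst h) \<le> H.nrm h" "K.nrm (snd h) \<le> H.nrm h" for h :: "'k \<times> 'k"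
    by (simp_all add: K.nrm_def H.nrm_def ipH_def K.ip_nonneg)
  have emb: "H.nrm (x, 0) = K.nrm x" "H.nrm (0, x) = K.nrm x" for x :: 'k
    by (simp_all add: K.nrm_def H.nrm_def ipH_def)
  have add: "X (x + y, 0) = X (x, 0) + X (y, 0)" "X (0, x + y) = X (0, x) + X (0, y)" for x y
    using lin(2)[of "(x, 0)" "(y, 0)"] lin(2)[of "(0, x)" "(0, y)"] by simp_all
  have scl: "X (scaleC r x, 0) = scH r (X (x, 0))" "X (0, scaleC r x) = scH r (X (0, x))" for r x
    using lin(3)[of r "(x, 0)"] lin(3)[of r "(0, x)"] by (simp_all add: scH_def)
  have "X h = X (fst h, 0) + X (0, snd h)" for h
    using lin(2)[of "(fst h, 0)" "(0, snd h)"] by simp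
  then have eq: "X = (\<lambda>h. (fst (X (fst h, 0)) + fst (X (0, snd h)), snd (X (fst h, 0)) + snd (X (0, snd h))))"
    by (metis (no_types) ext fst_add prod.collapse snd_add)
  have bd: "bdd_op scaleC cinner (\<lambda>x. fst (X (x, 0)))" "bdd_op scaleC cinner (\<lambda>x. fst (X (0, x)))"
    "bdd_op scaleC cinner (\<lambda>x. snd (X (x, 0)))" "bdd_op scaleC cinner (\<lambda>x. snd (X (0, x)))"
    by (rule K.bdd_opI[of _ k], simp add: clin_def add scl scH_def,
        rule order_trans[OF le(1) k[of "(_, 0)", unfolded emb]] order_trans[OF le(2) k[of "(_, 0)", unfolded emb]]
          order_trans[OF le(1) k[of "(0, _)", unfolded emb]] order_trans[OF le(2) k[of "(0, _)", unfolded emb]])+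
  show ?thesis by (rule that[OF bd eq])
qed

text \<open>A diagonal matrix with equal entries \<open>A\<close> acts entrywise on both sides of a
  product, so commuting with it means that each entry commutes with \<open>A\<close>. Evaluation at
  \<open>(x, 0)\<close> and \<open>(0, x)\<close> separates the entries.\<close>

lemma commutant_ampl2:
  fixes R :: "('k::chilbert \<Rightarrow> 'k) set"
  assumes R: "\<And>A. A \<in> R \<Longrightarrow> clin scaleC A"
  shows "commutant scH ipH (ampl2 R) = M2 (commutant scaleC cinner R)"
proof (intro equalityI subsetI)
  fix X assume X: "X \<in> commutant scH ipH (ampl2 R)"
  obtain a b c d where bdd: "bdd_op scaleC cinner a" "bdd_op scaleC cinner b"
      "bdd_op scaleC cinner c" "bdd_op scaleC cinner d"
    and eq: "X = (\<lambda>h. (a (fst h) + b (snd h), c (fst h) + d (snd h)))"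
    using matrix_of_bdd_op[OF H.commutant_bdd[OF X]] .
  note zero = bdd[THEN K.bdd_op_clin, THEN K.clin_0]
  have "a (A x) = A (a x) \<and> b (A x) = A (b x) \<and> c (A x) = A (c x) \<and> d (A x) = A (d x)" if A: "A \<in> R" for A x
  proof -
    have "(\<lambda>h. (A (fst h), A (snd h))) \<in> ampl2 R" using A by (auto simp: ampl2_def)
    then have "X (A (fst h), A (snd h)) = (A (fst (X h)), A (snd (X h)))" for h
      using H.commutant_eq[OF X] by fastforce
    from this[of "(x, 0)"] this[of "(0, x)"] show ?thesis
      by (simp add: eq zero K.clin_0[OF R[OF A]])
  qed
  then show "X \<in> M2 (commutant scaleC cinner R)"
    unfolding M2_def eq using bdd by (blast intro: K.commutantI)
next
  fix X assume "X \<in> M2 (commutant scaleC cinner R)"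
  then obtain a b c d where abcd: "a \<in> commutant scaleC cinner R" "b \<in> commutant scaleC cinner R"
      "c \<in> commutant scaleC cinner R" "d \<in> commutant scaleC cinner R"
    and eq: "X = (\<lambda>h. (a (fst h) + b (snd h), c (fst h) + d (snd h)))"
    unfolding M2_def by blast
  show "X \<in> commutant scH ipH (ampl2 R)"
  proof (rule H.commutantI)
    show "bdd_op scH ipH X"
      unfolding eq by (intro bdd_op_matrix abcd[THEN K.commutant_bdd])
    fix Z h assume "Z \<in> ampl2 R"
    then obtain A where A: "A \<in> R" "Z = (\<lambda>h. (A (fst h), A (snd h)))" by (auto simp: ampl2_def)
    show "X (Z h) = Z (X h)"
      by (simp add: eq A(2) K.clin_add[OF R[OF A(1)]] abcd[THEN K.commutant_eq, OF A(1)])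
  qed
qed

lemma commutant_ampl2_bicommutant:
  fixes B :: "'k::chilbert \<Rightarrow> 'k"
  assumes "bdd_op scaleC cinner B"
  shows "commutant scH ipH (ampl2 (commutant scaleC cinner (commutant scaleC cinner {B})))
    = M2 (commutant scaleC cinner {B})"
proof -
  have "commutant scH ipH (ampl2 (commutant scaleC cinner (commutant scaleC cinner {B})))
    = M2 (commutant scaleC cinner (commutant scaleC cinner (commutant scaleC cinner {B})))"
    by (rule commutant_ampl2) (rule K.bdd_op_clin[OF K.commutant_bdd])
  then show ?thesis using K.commutant3[of "{B}"] assms by simp
qed

section \<open>The algebra generated by all pairs\<close>

text \<open>\<open>D = B \<oplus> (-B)\<close> is not an amplification, but its square is that of
  \<open>B^2\<close>. Both projections commute with \<open>D^2\<close>, so their entries commute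
  with \<open>B^2\<close> and then, by \<open>commutant_square\<close>, with
  \<open>B\<close>.\<close>

lemma T_lam_subset_M2:
  fixes T :: "'k::chilbert \<times> 'k \<Rightarrow> 'k \<times> 'k" and B :: "'k \<Rightarrow> 'k" and lam :: real
  assumes T_B: "\<forall>x y. T (x, y) - scH (complex_of_real ((1 + lam) / 2)) (x, y) = (B x, - B y)"
    and B: "positive_op scaleC cinner B"
  shows "fst ` T_lam lam T \<union> snd ` T_lam lam T \<subseteq> M2 (commutant scaleC cinner {B})"
proof -
  have linB: "clin scaleC B" using K.selfadj_clin[OF K.positive_opD(1)[OF B]] .
  define D where "D h = (B (fst h), - B (snd h))" for h :: "'k \<times> 'k"
  have DD: "D (D h) = (B (B (fst h)), B (B (snd h)))" for h
    by (simp add: D_def K.clin_minus[OF linB])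
  have mem: "R \<in> M2 (commutant scaleC cinner {B})"
    if R: "is_proj scH ipH R" "\<And>h. R (D (D h)) = D (D (R h))" for R
  proof -
    have "R \<in> commutant scH ipH (ampl2 {\<lambda>x. B (B x)})"
    proof (rule H.commutantI)
      show "bdd_op scH ipH R" using R(1) H.selfadj_bdd by (auto simp: is_proj_def)
    qed (use R(2)[unfolded DD] in \<open>auto simp: ampl2_def\<close>)
    also have "\<dots> = M2 (commutant scaleC cinner {\<lambda>x. B (B x)})"
      by (rule commutant_ampl2) (use linB in \<open>auto simp: clin_def\<close>)
    also have "\<dots> \<subseteq> M2 (commutant scaleC cinner {B})"
      using K.commutant_square[OF B] unfolding M2_def by blast
    finally show ?thesis .
  qed
  have "P \<in> M2 (commutant scaleC cinner {B}) \<and> Q \<in> M2 (commutant scaleC cinner {B})"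
    if PQ: "(P, Q) \<in> T_lam lam T" for P Q
  proof -
    have P: "is_proj scH ipH P" and Q: "is_proj scH ipH Q"
      and T: "\<And>h. T h = scH (complex_of_real lam) (P h) + Q h"
      using PQ by (auto simp: T_lam_def)
    have D: "D h = scH (complex_of_real lam) (P h) + Q h - scH (complex_of_real ((1 + lam) / 2)) h" for h
      using T_B T[of h] by (metis D_def prod.collapse)
    show ?thesis
      using mem[OF P] mem[OF Q] H.proj_pair_commute[OF P Q D] by blast
  qed
  then show ?thesis by force
qed

text \<open>The pair \<open>n\<close>, \<open>n'\<close> stands for \<open>s W\<close> and its
  adjoint. The relations \<open>unit\<close> give \<open>U^2 = 1\<close>. The off-diagonal terms
  cancel in \<open>D U + U D\<close>, which is the amplification of \<open>2 c B\<close>; this is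
  why only \<open>c\<close> is tied to \<open>B\<close>.\<close>

lemma T_lam_rotation:
  fixes T :: "'k::chilbert \<times> 'k \<Rightarrow> 'k \<times> 'k" and B :: "'k \<Rightarrow> 'k" and lam :: real
  assumes T_B: "\<And>x y. T (x, y) = scH (complex_of_real ((1 + lam) / 2)) (x, y) + (B x, - B y)"
    and B: "selfadj scaleC cinner B" and c: "selfadj scaleC cinner c"
    and n: "bdd_op scaleC cinner n" "bdd_op scaleC cinner n'" "is_adjoint cinner n n'"
    and comm: "\<And>x. B (c x) = c (B x)" "\<And>x. B (n x) = n (B x)" "\<And>x. B (n' x) = n' (B x)"
      "\<And>x. c (n x) = n (c x)" "\<And>x. c (n' x) = n' (c x)"
    and unit: "\<And>x. c (c x) + n' (n x) = x" "\<And>x. c (c x) + n (n' x) = x"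
    and cB: "\<And>x. scaleC (of_real (4 * lam)) (c (B x)) = scaleC 4 (B (B x)) + scaleC (of_real (lam\<^sup>2 - 1)) x"
  defines "U \<equiv> \<lambda>h. (c (fst h) + n' (snd h), n (fst h) - c (snd h))"
  shows "\<exists>Q. (\<lambda>h. scH (1/2) (h + U h), Q) \<in> T_lam lam T"
proof -
  note lin = K.clin_simps[OF K.selfadj_clin[OF B]] K.clin_simps[OF K.selfadj_clin[OF c]]
    K.clin_simps[OF K.bdd_op_clin[OF n(1)]] K.clin_simps[OF K.bdd_op_clin[OF n(2)]]
  have n'n: "n' (n x) = x - c (c x)" and nn': "n (n' x) = x - c (c x)" for x
    using unit[of x] by (simp_all add: algebra_simps)
  have U: "selfadj scH ipH U"
  proof (rule H.selfadjI)
    show "bdd_op scH ipH U"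
      using bdd_op_matrix[OF K.selfadj_bdd[OF c] n(2,1) K.bdd_op_minus[OF K.selfadj_bdd[OF c]]]
      by (simp add: U_def)
    show "is_adjoint ipH U U"
      using K.selfadj_adj[OF c] n(3) K.is_adjoint_sym[OF n(3)]
      by (simp add: is_adjoint_def ipH_def U_def K.ip_simps)
  qed
  have UU: "U (U h) = h" for h
    by (simp add: U_def lin comm n'n nn' prod_eq_iff)
  define D where "D h = (B (fst h), - B (snd h))" for h :: "'k \<times> 'k"
  have D: "selfadj scH ipH D"
  proof (rule H.selfadjI)
    show "bdd_op scH ipH D"
      using bdd_op_matrix[OF K.selfadj_bdd[OF B] K.bdd_op_0 K.bdd_op_0 K.bdd_op_minus[OF K.selfadj_bdd[OF B]]]
      by (simp add: D_def[abs_def])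
    show "is_adjoint ipH D D"
      using K.selfadj_adj[OF B] by (simp add: is_adjoint_def ipH_def D_def)
  qed
  \<comment> \<open>\<open>V\<close> is forced by \<open>2 D = lam U + V\<close>. Its square
    \<open>4 D^2 - 2 lam (D U + U D) + lam^2\<close> amplifies
    \<open>4 B^2 - 4 lam c B + lam^2\<close>, which is 1 by \<open>cB\<close>.\<close>
  define V where "V = (\<lambda>h. scH (of_real 2) (D h) - scH (of_real lam) (U h))"
  have V: "selfadj scH ipH V"
    unfolding V_def by (intro H.selfadj_diff H.selfadj_sc U D)
  have VV: "V (V h) = h" for h
  proof -
    have cBz: "complex_of_real (4 * lam) * cinner z (c (B x))
      = 4 * cinner z (B (B x)) + complex_of_real (lam\<^sup>2 - 1) * cinner z x" for x z
      using arg_cong[OF cB[of x], of "cinner z"] by (simp add: K.ip_simps)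
    have "fst (V (V h)) = fst h"
      by (rule K.ip_ext, use cBz[of _ "fst h"] in \<open>simp add: V_def U_def D_def scH_def lin comm n'n nn' K.ip_simps\<close>,
        simp add: algebra_simps power2_eq_square)
    moreover have "snd (V (V h)) = snd h"
      by (rule K.ip_ext, use cBz[of _ "snd h"] in \<open>simp add: V_def U_def D_def scH_def lin comm n'n nn' K.ip_simps\<close>,
        simp add: algebra_simps power2_eq_square)
    ultimately show ?thesis by (simp add: prod_eq_iff)
  qed
  have "T h = scH (complex_of_real lam) (scH (1/2) (h + U h)) + scH (1/2) (h + V h)" for h
  proof -
    have "T h = scH (complex_of_real ((1 + lam) / 2)) h + D h"
      using T_B[of "fst h" "snd h"] by (simp add: D_def)
    then show ?thesis
      by (intro H.ip_ext) (simp add: V_def H.ip_simps field_simps)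
  qed
  then have "(\<lambda>h. scH (1/2) (h + U h), \<lambda>h. scH (1/2) (h + V h)) \<in> T_lam lam T"
    unfolding T_lam_def
    using H.is_proj_reflection[OF U UU] H.is_proj_reflection[OF V VV] by auto
  then show ?thesis by blast
qed

text \<open>The inclusion from right to left dualises \<open>T_lam_subset_M2\<close>. For the other
  one, \<open>X\<close> is tested against the explicit family of solutions indexed by the unitaries
  \<open>W\<close> commuting with \<open>B\<close>.\<close>

lemma commutant_T_lam:
  fixes T :: "'k::chilbert \<times> 'k \<Rightarrow> 'k \<times> 'k" and B :: "'k \<Rightarrow> 'k" and lam :: real
  assumes lam: "lam \<noteq> 0"
    and T_B: "\<forall>x y. T (x, y) - scH (complex_of_real ((1 + lam) / 2)) (x, y) = (B x, - B y)"
    and B: "positive_op scaleC cinner B"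
    and lower: "op_less scaleC cinner (\<lambda>x. scaleC (complex_of_real (\<bar>1 - \<bar>lam\<bar>\<bar> / 2)) x) B"
    and upper: "op_less scaleC cinner B (\<lambda>x. scaleC (complex_of_real ((1 + \<bar>lam\<bar>) / 2)) x)"
  shows "commutant scH ipH (fst ` T_lam lam T \<union> snd ` T_lam lam T)
    = ampl2 (commutant scaleC cinner (commutant scaleC cinner {B}))" (is "commutant scH ipH ?S = ampl2 ?M")
proof
  note Bs = K.positive_opD(1)[OF B]
  note Bb = K.selfadj_bdd[OF Bs]
  note linB = K.clin_simps[OF K.selfadj_clin[OF Bs]]
  have Mlin: "clin scaleC A" if "A \<in> commutant scaleC cinner F" for A and F :: "('k \<Rightarrow> 'k) set"
    using that K.commutant_bdd K.bdd_op_clin by blast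
  have "?S \<subseteq> commutant scH ipH (ampl2 ?M)"
    using T_lam_subset_M2[OF T_B B]
    unfolding commutant_ampl2_bicommutant[OF Bb] .
  then have "commutant scH ipH (commutant scH ipH (ampl2 ?M)) \<subseteq> commutant scH ipH ?S"
    by (rule H.commutant_antimono)
  moreover have "ampl2 ?M \<subseteq> commutant scH ipH (commutant scH ipH (ampl2 ?M))"
  proof (rule H.subset_bicommutant)
    fix Z assume "Z \<in> ampl2 ?M"
    then obtain A where A: "A \<in> ?M" "Z = (\<lambda>h. (A (fst h), A (snd h)))" by (auto simp: ampl2_def)
    show "bdd_op scH ipH Z"
      using bdd_op_matrix[OF K.commutant_bdd[OF A(1)] K.bdd_op_0 K.bdd_op_0 K.commutant_bdd[OF A(1)]]
      by (simp add: A(2))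
  qed
  ultimately show "ampl2 ?M \<subseteq> commutant scH ipH ?S" by blast
  show "commutant scH ipH ?S \<subseteq> ampl2 ?M"
  proof
    fix X assume X: "X \<in> commutant scH ipH ?S"
    obtain c s where c: "selfadj scaleC cinner c" "c \<in> ?M" and s: "selfadj scaleC cinner s" "s \<in> ?M"
      and s0: "\<And>x. s x = 0 \<Longrightarrow> x = 0" and cs: "\<And>x. c (c x) + s (s x) = x"
      and cB: "\<And>x. scaleC (of_real (4 * lam)) (c (B x)) = scaleC 4 (B (B x)) + scaleC (of_real (lam\<^sup>2 - 1)) x"
      using K.angle_operators[OF lam B lower upper] by metis
    have T_B': "T (x, y) = scH (complex_of_real ((1 + lam) / 2)) (x, y) + (B x, - B y)" for x y
      using T_B[rule_format, of x y] by (metis add.commute diff_add_cancel)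
    have BB': "B \<in> commutant scaleC cinner {B}" by (rule K.commutantI) (simp_all add: Bb)
    have BM: "B \<in> ?M" using K.subset_bicommutant[of "{B}"] Bb by blast
    let ?P = "\<lambda>W W' h. scH (1/2) (h + (c (fst h) + W' (s (snd h)), s (W (fst h)) - c (snd h)))"
    have pair: "\<exists>Q. (?P W W', Q) \<in> T_lam lam T"
      if W: "W \<in> commutant scaleC cinner {B}" "W' \<in> commutant scaleC cinner {B}" "is_adjoint cinner W W'"
        "\<And>x. W (W' x) = x" "\<And>x. W' (W x) = x" for W W'
    proof -
      have cm: "A (W x) = W (A x)" "A (W' x) = W' (A x)" if "A \<in> ?M" for A x
        using K.commutant_eq[OF that] W by blast+
      have ab: "A (A' x) = A' (A x)" if "A \<in> ?M" "A' \<in> ?M" for A A' x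
        by (rule K.bicommutant_commute[OF Bb that])
      have "\<exists>Q. (\<lambda>h. scH (1/2) (h + (c (fst h) + (\<lambda>x. W' (s x)) (snd h), (\<lambda>x. s (W x)) (fst h) - c (snd h))), Q) \<in> T_lam lam T"
      proof (rule T_lam_rotation[OF T_B' Bs c(1)])
        show "bdd_op scaleC cinner (\<lambda>x. s (W x))"
          by (rule K.bdd_op_comp[OF K.selfadj_bdd[OF s(1)] K.commutant_bdd[OF W(1)]])
        show "bdd_op scaleC cinner (\<lambda>x. W' (s x))"
          by (rule K.bdd_op_comp[OF K.commutant_bdd[OF W(2)] K.selfadj_bdd[OF s(1)]])
        show "is_adjoint cinner (\<lambda>x. s (W x)) (\<lambda>x. W' (s x))"
          by (rule K.is_adjoint_comp[OF K.selfadj_adj[OF s(1)] W(3)])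
        show "B (c x) = c (B x)" for x by (rule ab[OF BM c(2)])
        show "B (s (W x)) = s (W (B x))" for x by (simp only: ab[OF BM s(2)] cm(1)[OF BM])
        show "B (W' (s x)) = W' (s (B x))" for x by (simp only: ab[OF BM s(2)] cm(2)[OF BM])
        show "c (s (W x)) = s (W (c x))" for x by (simp only: ab[OF c(2) s(2)] cm(1)[OF c(2)])
        show "c (W' (s x)) = W' (s (c x))" for x by (simp only: ab[OF c(2) s(2)] cm(2)[OF c(2)])
        show "c (c x) + W' (s (s (W x))) = x" for x by (simp only: cm(1)[OF s(2)] W(5) cs)
        show "c (c x) + s (W (W' (s x))) = x" for x by (simp only: W(4) cs)
      qed (rule cB)
      then show ?thesis by simp
    qed
    have XP: "X (?P W W' h) = ?P W W' (X h)"
      if W: "W \<in> commutant scaleC cinner {B}" "W' \<in> commutant scaleC cinner {B}" "is_adjoint cinner W W'"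
        "\<And>x. W (W' x) = x" "\<And>x. W' (W x) = x" for W W' h
    proof -
      have "?P W W' \<in> ?S" using pair[OF W] by force
      then show ?thesis by (rule H.commutant_eq[OF X])
    qed
    have idB: "(\<lambda>x. x) \<in> commutant scaleC cinner {B}"
      by (rule K.commutantI) (simp_all add: K.bdd_op_id)
    note linX = H.clin_simps[OF H.bdd_op_clin[OF H.commutant_bdd[OF X]]]
    \<comment> \<open>Taking \<open>W = 1\<close> shows that \<open>T_lam\<close> is nonempty;
      \<open>X\<close> commutes with this \<open>P\<close> and \<open>Q\<close>, hence with
      \<open>T\<close> and with \<open>D\<close>.\<close>
    obtain P Q where PQ: "(P, Q) \<in> T_lam lam T"
      using pair[OF idB idB K.is_adjoint_id] by auto
    then have "P \<in> ?S" "Q \<in> ?S" by force+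
    then have "X (T h) = T (X h)" for h
      using PQ by (auto simp: T_lam_def linX H.commutant_eq[OF X])
    then have "X (T (x, y) - scH (complex_of_real ((1 + lam) / 2)) (x, y))
      = T (X (x, y)) - scH (complex_of_real ((1 + lam) / 2)) (X (x, y))" for x y
      by (simp add: linX)
    then have XD: "X (B x, - B y) = (B (fst (X (x, y))), - B (snd (X (x, y))))" for x y
      using T_B by (metis prod.collapse)
    obtain a b e d where bdd: "bdd_op scaleC cinner a" "bdd_op scaleC cinner b"
        "bdd_op scaleC cinner e" "bdd_op scaleC cinner d"
      and eq: "X = (\<lambda>h. (a (fst h) + b (snd h), e (fst h) + d (snd h)))"
      using matrix_of_bdd_op[OF H.commutant_bdd[OF X]] .
    note lin = bdd[THEN K.bdd_op_clin, THEN K.clin_0] bdd[THEN K.bdd_op_clin, THEN K.clin_minus]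
      bdd[THEN K.bdd_op_clin, THEN K.clin_add] bdd[THEN K.bdd_op_clin, THEN K.clin_sc]
    \<comment> \<open>The opposite signs in \<open>D\<close> make the off-diagonal entries
      anticommute with \<open>B\<close>, while the diagonal ones commute with it.\<close>
    have aB: "a (B x) = B (a x)" and eB: "e (B x) = - B (e x)" for x
      using XD[of x 0] by (simp_all add: eq lin linB)
    have bB: "b (B x) = - B (b x)" and dB: "d (B x) = B (d x)" for x
      using XD[of 0 x] by (simp_all add: eq lin linB minus_equation_iff)
    \<comment> \<open>If \<open>\<bar>lam\<bar> \<noteq> 1\<close>, the lower form bound is
      positive; otherwise the bounding scalar is 0 and injectivity is the strictness of
      \<open>lower\<close>.\<close>
    have B0: "x = 0" if "B x = 0" for x
    proof -
      have "\<bar>1 - \<bar>lam\<bar>\<bar> / 2 * (K.nrm x)\<^sup>2 \<le> 0"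
        using K.op_less_scalar_left(1)[OF lower, of x] that by simp
      then have "\<bar>1 - \<bar>lam\<bar>\<bar> = 0 \<or> x = 0" by (auto simp: mult_le_0_iff)
      then show ?thesis using K.op_less_scalar_left(2)[OF lower, of x] that by auto
    qed
    \<comment> \<open>\<open>g\<close> anticommutes with \<open>B\<close>, so it commutes with \<open>B\<^sup>2\<close>, hence with \<open>B\<close>, and \<open>2Bg = 0\<close>.\<close>
    have anti: "g x = 0" if g: "bdd_op scaleC cinner g" "\<And>x. g (B x) = - B (g x)" for g x
    proof -
      have "g \<in> commutant scaleC cinner {\<lambda>x. B (B x)}"
        by (rule K.commutantI[OF g(1)]) (auto simp: g(2) linB)
      then have "g \<in> commutant scaleC cinner {B}" using K.commutant_square[OF B] by blast
      then have "g (B x) = B (g x)" by (rule K.commutant_eq) simp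
      with g(2)[of x] have "B (g x) + B (g x) = 0" by (metis add.right_inverse)
      then have "scaleC 2 (B (g x)) = 0"
        using K.sc_add_left[of 1 1 "B (g x)"] by simp
      then show ?thesis using B0 by simp
    qed
    have b0: "b x = 0" and e0: "e x = 0" for x
      using anti[OF bdd(2) bB] anti[OF bdd(3) eB] by blast+
    \<comment> \<open>Compares the second components of \<open>X P = P X\<close> at
      \<open>(x, 0)\<close>, with \<open>X\<close> already known to be diagonal.\<close>
    have dW: "d (s (W x)) = s (W (a x))"
      if W: "W \<in> commutant scaleC cinner {B}" "W' \<in> commutant scaleC cinner {B}" "is_adjoint cinner W W'"
        "\<And>x. W (W' x) = x" "\<And>x. W' (W x) = x" for W W' x
    proof -
      have "W' (s 0) = 0" "W 0 = 0" "s 0 = 0" "c 0 = 0"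
        using K.clin_0 Mlin[OF W(1)] Mlin[OF W(2)] Mlin[OF s(2)] Mlin[OF c(2)] by metis+
      then show ?thesis
        using XP[OF W, of "(x, 0)"] by (simp add: eq b0 e0 lin scH_def)
    qed
    have dM: "d \<in> commutant scaleC cinner {B}" using K.commutantI[OF bdd(4)] dB by blast
    \<comment> \<open>For \<open>W = 1\<close>, \<open>dW\<close> reads \<open>d s = s a\<close>.
      Since \<open>d\<close> commutes with \<open>B\<close>, it commutes with \<open>s\<close>, and
      the injective \<open>s\<close> cancels.\<close>
    have da: "d x = a x" for x
    proof -
      have "s (d x) = s (a x)"
        using dW[OF idB idB K.is_adjoint_id] K.commutant_eq[OF s(2) dM] by simp
      then have "s (d x - a x) = 0" by (simp add: K.clin_diff[OF Mlin[OF s(2)]])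
      then show ?thesis using s0 by fastforce
    qed
    \<comment> \<open>With \<open>d = a\<close>, \<open>dW\<close> becomes
      \<open>s a W = s W a\<close>. Cancelling \<open>s\<close> shows that \<open>a\<close> commutes
      with the unitaries \<open>W\<close>, which suffices by
      \<open>commutant_unitaries\<close>.\<close>
    have "a \<in> ?M"
    proof (rule K.commutant_unitaries[OF _ _ bdd(1)])
      show "\<exists>Z'\<in>{B}. is_adjoint cinner Z Z'" if "Z \<in> {B}" for Z
        using that K.selfadj_adj[OF Bs] by simp
      show "bdd_op scaleC cinner Z" if "Z \<in> {B}" for Z using that Bb by simp
      fix W W' x
      assume W: "W \<in> commutant scaleC cinner {B}" "W' \<in> commutant scaleC cinner {B}" "is_adjoint cinner W W'"
        "\<And>x. W (W' x) = x" "\<And>x. W' (W x) = x"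
      have "s (a (W x)) = s (W (a x))"
        using dW[OF W, of x] K.commutant_eq[OF s(2) dM, of "W x"] by (simp add: da)
      then have "s (a (W x) - W (a x)) = 0" by (simp add: K.clin_diff[OF Mlin[OF s(2)]])
      then show "a (W x) = W (a x)" using s0 by fastforce
    qed
    then show "X \<in> ampl2 ?M" unfolding ampl2_def eq by (auto simp: b0 e0 da)
  qed
qed

theorem theorem2p5:
  fixes lam :: real
    and T :: "'k::chilbert \<times> 'k \<Rightarrow> 'k \<times> 'k"
    and B :: "'k \<Rightarrow> 'k"
  assumes infdim: "infinite_dimensional TYPE('k)"
    and lam: "lam \<noteq> -1" "lam \<noteq> 0"
    and T_sa: "selfadj scH ipH T"
    and T_gen: "generic_position lam T"
    and T_B: "\<forall>x y. T (x, y) - scH (complex_of_real ((1 + lam) / 2)) (x, y) = (B x, - B y)"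
    and B_pos: "positive_op scaleC cinner B"
    and B_lower: "op_less scaleC cinner
                    (\<lambda>x. scaleC (complex_of_real (\<bar>1 - \<bar>lam\<bar>\<bar> / 2)) x) B"
    and B_upper: "op_less scaleC cinner B
                    (\<lambda>x. scaleC (complex_of_real ((1 + \<bar>lam\<bar>) / 2)) x)"
  shows "Wstar scH ipH (fst ` T_lam lam T \<union> snd ` T_lam lam T)
           = M2 (commutant scaleC cinner {B})
         \<and> commutant scH ipH (Wstar scH ipH (fst ` T_lam lam T \<union> snd ` T_lam lam T))
           = ampl2 (Wstar scaleC cinner {B})"
proof -
  let ?S = "fst ` T_lam lam T \<union> snd ` T_lam lam T"
  note comm = commutant_T_lam[OF lam(2) T_B B_pos B_lower B_upper]
  have S: "selfadj scH ipH X" if "X \<in> ?S" for X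
    using that by (auto simp: T_lam_def is_proj_def)
  have B: "selfadj scaleC cinner X" if "X \<in> {B}" for X
    using that K.positive_opD(1)[OF B_pos] by simp
  have WB: "Wstar scaleC cinner {B} = commutant scaleC cinner (commutant scaleC cinner {B})"
    by (rule K.Wstar_eq_bicommutant) (rule B)
  have WS: "Wstar scH ipH ?S = commutant scH ipH (commutant scH ipH ?S)"
    by (rule H.Wstar_eq_bicommutant) (rule S)
  \<comment> \<open>Reduces the second identity to \<open>comm\<close>; the first one is the
    commutant of \<open>comm\<close>.\<close>
  have S3: "commutant scH ipH (commutant scH ipH (commutant scH ipH ?S)) = commutant scH ipH ?S"
    by (rule H.commutant3) (rule H.selfadj_bdd[OF S])
  have "Wstar scH ipH ?S = M2 (commutant scaleC cinner {B})"
    unfolding WS comm by (rule commutant_ampl2_bicommutant) (simp add: K.selfadj_bdd[OF B])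
  moreover have "commutant scH ipH (Wstar scH ipH ?S) = ampl2 (Wstar scaleC cinner {B})"
    unfolding WS WB S3 by (rule comm)
  ultimately show ?thesis by blast
qed

end
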